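(* Let $\alpha,\beta\ge 0$ with $\alpha+\beta>0$, put $k=\frac{\alpha-\beta}{\alpha+\beta}$ and $M=\frac{\alpha+\beta}{2\sqrt2}$, and let $(\mathbb C^2,g,J)$ be the generalized Taub-NUT Kähler surface with parameters $\alpha,\beta$. Assume $k\in(-1,1)$. Then $(\mathbb C^2,g,J)$ is a QCH Kähler surface of orthotoric type. More precisely, there are real numbers $a,b,c,d$ with $a>0$, $c>0$, $da-bc>0$ such that $$M=\frac{(c+a)a^2c^2}{4(da-bc)^2},\qquad k=\frac{a-c}{a+c},$$ and such that on an open and dense subset of $\mathbb C^2$ the metric is (in suitable local coordinates $(\xi,\eta,t,z)$ near each point of that subset) $$g=(\xi-\eta)\Big(\frac{1}{F(\xi)}d\xi^2-\frac{1}{G(\eta)}d\eta^2\Big)+\frac{1}{\xi-\eta}\Big(F(\xi)(dt+\eta\,dz)^2-G(\eta)(dt+\xi\,dz)^2\Big),$$ where $F(\xi)=a\xi+b$ and $G(\eta)=c\eta+d$.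
   Context: Generalized Taub-NUT Kähler surface with parameters $\alpha,\beta\ge0$, $\alpha+\beta>0$ (with $k=\frac{\alpha-\beta}{\alpha+\beta}$, $M=\frac{\alpha+\beta}{2\sqrt2}$): on the half plane $\Sigma$ with interior $\{(x,y)\in\mathbb R^2: x>0\}$ consider $$\psi_1=\tfrac{1}{\sqrt2}\big(-y+\sqrt{x^2+y^2}\big)+\tfrac{\alpha}{2}x^2,\qquad \psi_2=\tfrac{1}{\sqrt2}\big(y+\sqrt{x^2+y^2}\big)+\tfrac{\beta}{2}x^2,$$ $$g_\Sigma=\frac{1+2M(ky+\sqrt{x^2+y^2})}{\sqrt{x^2+y^2}}\,(dx\otimes dx+dy\otimes dy).$$ Let $G^{ij}=g_\Sigma(\nabla\psi_i,\nabla\psi_j)$, $i,j=1,2$ (gradients with respect to $g_\Sigma$). On $\{x>0\}\times T^2$, with angular coordinates $\theta_1,\theta_2$ (each taken modulo $2\sqrt2\pi$) on $T^2$, put $$g=g_\Sigma+\sum_{i,j}G^{ij}\,d\theta_i\,d\theta_j,\qquad \omega=d\psi_1\wedge d\theta_1+d\psi_2\wedge d\theta_2,$$ and let $J$ be defined by $\omega(X,Y)=g(JX,Y)$. This Kähler structure is regarded as living on the open dense subset $(\mathbb C\setminus\{0\})^2\subset\mathbb C^2$ via $z_1=v\,e^{i\theta_1/\sqrt2}$, $z_2=u\,e^{i\theta_2/\sqrt2}$, where $u,v>0$, $u^2=M(\sqrt{x^2+y^2}+y)$, $v^2=M(\sqrt{x^2+y^2}-y)$ (so $x=uv/M$); it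 extends smoothly to all of $\mathbb C^2=\mathbb R^4$ (as a smooth manifold), and the extension is the generalized Taub-NUT Kähler surface. Here $x=\sqrt{|X_1|^2|X_2|^2-\langle X_1,X_2\rangle^2}$ with $X_i=\partial/\partial\theta_i=J\nabla\psi_i$. The symbol $M$ denotes the constant above, not the manifold. QCH Kähler surface: a Kähler surface $(N,g,J)$ (real dimension 4) admitting a global 2-dimensional $J$-invariant distribution $\mathcal D\subset TN$ such that, for every $p\in N$ and every $J$-invariant 2-plane $\pi\subset T_pN$ with $X\in\pi$, $g(X,X)=1$, the holomorphic curvature $K(\pi)=R(X,JX,JX,X)$ depends only on the point $p$ and the number $|X_{\mathcal D}|=\sqrt{g(X_{\mathcal D},X_{\mathcal D})}$, where $X_{\mathcal D}$ is the orthogonal projection of $X$ onto $\mathcal D$. Orthotoric type: a Kähler surface is an orthotoric type Kähler surface if its metric has (in local coordinates $(\xi,\eta,t,z)$) the form $$(\xi-\eta)\Big(\frac{1}{F(\xi)}d\xi^2-\frac{1}{G(\eta)}d\eta^2\Big)+\frac{1}{\xi-\eta}\Big(F(\xi)(dt+\eta\,dz)^2-G(\eta)(dt+\xi\,dz)^2\Big)$$ for some functions $F,G$ of one variable (on a region where this is positive definite: $\xi>\eta$, $F(\xi)>0$, $G(\eta)<0$). A QCH Kähler surface $(N,g,J)$ is said to be of orthotoric type if there is an open dense subset $U\subset N$ such that $(U,g|_U,J|_U)$ is an orthotoric type Kähler surface. *)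

theory Defs
  imports "HOL-Analysis.Analysis"
begin

section \<open>Riemannian and Kaehler geometry on an open subset of a Euclidean space\<close>

text \<open>All manifolds below are open subsets \<open>N\<close> of a Euclidean space \<open>'a\<close>, and every tangent space is identified with \<open>'a\<close>. A metric is a map
  \<open>g\<close> with \<open>g p X Y\<close> the value at \<open>p\<close> on tangent vectors \<open>X, Y\<close>; similarly \<open>J p X\<close>.\<close>

text \<open>\<open>C\<^sup>k\<close> functions on an open set, through iterated directional derivatives.\<close>

primrec Ck_on :: "nat \<Rightarrow> 'a::euclidean_space set \<Rightarrow> ('a \<Rightarrow> 'b::real_normed_vector) \<Rightarrow> bool" where
  "Ck_on 0 S f \<longleftrightarrow> continuous_on S f"
| "Ck_on (Suc n) S f \<longleftrightarrow>
     (\<forall>p\<in>S. f differentiable (at p)) \<and> (\<forall>v. Ck_on n S (\<lambda>p. frechet_derivative f (at p) v))"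

definition smooth_on :: "'a::euclidean_space set \<Rightarrow> ('a \<Rightarrow> 'b::real_normed_vector) \<Rightarrow> bool" where
  "smooth_on S f \<longleftrightarrow> (\<forall>n. Ck_on n S f)"

type_synonym 'a metric_tensor = "'a \<Rightarrow> 'a \<Rightarrow> 'a \<Rightarrow> real"
type_synonym 'a endo_field = "'a \<Rightarrow> 'a \<Rightarrow> 'a"

definition riemannian_metric_on :: "'a::euclidean_space set \<Rightarrow> 'a metric_tensor \<Rightarrow> bool" where
  "riemannian_metric_on N g \<longleftrightarrow>
     open N \<and>
     (\<forall>p\<in>N. bilinear (g p) \<and> (\<forall>X Y. g p X Y = g p Y X) \<and> (\<forall>X. X \<noteq> 0 \<longrightarrow> g p X X > 0)) \<and>
     (\<forall>X Y. smooth_on N (\<lambda>p. g p X Y))"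

definition grad :: "'a::euclidean_space metric_tensor \<Rightarrow> ('a \<Rightarrow> real) \<Rightarrow> 'a \<Rightarrow> 'a" where
  "grad g f p = (THE V. \<forall>X. g p V X = frechet_derivative f (at p) X)"

text \<open>The Levi-Civita derivative \<open>\<nabla>\<^sub>X Y\<close> of the constant vector fields \<open>X, Y\<close> at \<open>p\<close>, given by the
  Koszul formula (constant fields commute).\<close>

definition christoffel :: "'a::euclidean_space metric_tensor \<Rightarrow> 'a \<Rightarrow> 'a \<Rightarrow> 'a \<Rightarrow> 'a" where
  "christoffel g p X Y =
     (THE V. \<forall>Z. 2 * g p V Z =
        frechet_derivative (\<lambda>q. g q Y Z) (at p) X
      + frechet_derivative (\<lambda>q. g q X Z) (at p) Y
      - frechet_derivative (\<lambda>q. g q X Y) (at p) Z)"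

definition cov_deriv :: "'a::euclidean_space metric_tensor \<Rightarrow> ('a \<Rightarrow> 'a) \<Rightarrow> ('a \<Rightarrow> 'a) \<Rightarrow> 'a \<Rightarrow> 'a" where
  "cov_deriv g X Y p = frechet_derivative Y (at p) (X p) + christoffel g p (X p) (Y p)"

text \<open>\<open>R(X,Y)Z = \<nabla>\<^sub>X\<nabla>\<^sub>Y Z - \<nabla>\<^sub>Y\<nabla>\<^sub>X Z - \<nabla>\<^bsub>[X,Y]\<^esub> Z\<close>, computed with the constant extensions of the
  tangent vectors, for which the bracket vanishes; \<open>R(X,Y,Z,W) = g(R(X,Y)Z,W)\<close>.\<close>

definition riemann_curv :: "'a::euclidean_space metric_tensor \<Rightarrow> 'a \<Rightarrow> 'a \<Rightarrow> 'a \<Rightarrow> 'a \<Rightarrow> 'a \<Rightarrow> real" where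
  "riemann_curv g p X Y Z W =
     g p (cov_deriv g (\<lambda>_. X) (cov_deriv g (\<lambda>_. Y) (\<lambda>_. Z)) p
        - cov_deriv g (\<lambda>_. Y) (cov_deriv g (\<lambda>_. X) (\<lambda>_. Z)) p) W"

text \<open>An almost Hermitian structure with parallel \<open>J\<close>. As \<open>\<nabla>J\<close> is a tensor, it suffices to test
  \<open>(\<nabla>\<^sub>X J)Y = \<nabla>\<^sub>X(JY) - J\<nabla>\<^sub>X Y = 0\<close> on constant fields.\<close>

definition kaehler_surface :: "'a::euclidean_space set \<Rightarrow> 'a metric_tensor \<Rightarrow> 'a endo_field \<Rightarrow> bool" where
  "kaehler_surface N g J \<longleftrightarrow>
     DIM('a) = 4 \<and> riemannian_metric_on N g \<and>
     (\<forall>p\<in>N. linear (J p) \<and> (\<forall>X. J p (J p X) = - X) \<and> (\<forall>X Y. g p (J p X) (J p Y) = g p X Y)) \<and>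
     (\<forall>X. smooth_on N (\<lambda>p. J p X)) \<and>
     (\<forall>p\<in>N. \<forall>X Y. cov_deriv g (\<lambda>_. X) (\<lambda>q. J q Y) p = J p (cov_deriv g (\<lambda>_. X) (\<lambda>_. Y) p))"

definition plane_distribution_on :: "'a::euclidean_space set \<Rightarrow> ('a \<Rightarrow> 'a set) \<Rightarrow> bool" where
  "plane_distribution_on N D \<longleftrightarrow>
     (\<forall>p\<in>N. subspace (D p) \<and> dim (D p) = 2) \<and>
     (\<forall>p\<in>N. \<exists>V A B. open V \<and> p \<in> V \<and> V \<subseteq> N \<and> smooth_on V A \<and> smooth_on V B \<and>
        (\<forall>q\<in>V. D q = span {A q, B q}))"

definition orth_proj :: "'a::euclidean_space metric_tensor \<Rightarrow> ('a \<Rightarrow> 'a set) \<Rightarrow> 'a \<Rightarrow> 'a \<Rightarrow> 'a" where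
  "orth_proj g D p X = (THE V. V \<in> D p \<and> (\<forall>W\<in>D p. g p (X - V) W = 0))"

text \<open>A \<open>J\<close>-invariant plane containing the unit vector \<open>X\<close> is the span of \<open>X\<close> and \<open>JX\<close>, so it is
  enough to quantify over unit vectors; \<open>K\<close> expresses the dependence on \<open>p\<close> and \<open>|X\<^sub>D|\<close> only.\<close>

definition QCH_kaehler_surface ::
    "'a::euclidean_space set \<Rightarrow> 'a metric_tensor \<Rightarrow> 'a endo_field \<Rightarrow> bool" where
  "QCH_kaehler_surface N g J \<longleftrightarrow>
     kaehler_surface N g J \<and>
     (\<exists>D. plane_distribution_on N D \<and> (\<forall>p\<in>N. J p ` D p \<subseteq> D p) \<and>
        (\<exists>K :: 'a \<Rightarrow> real \<Rightarrow> real. \<forall>p\<in>N. \<forall>X. g p X X = 1 \<longrightarrow>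
           riemann_curv g p X (J p X) (J p X) X =
             K p (sqrt (g p (orth_proj g D p X) (orth_proj g D p X)))))"

section \<open>Orthotoric type\<close>

type_synonym R4 = "real \<times> real \<times> real \<times> real"

definition smooth_chart :: "'a::euclidean_space set \<Rightarrow> ('a \<Rightarrow> R4) \<Rightarrow> bool" where
  "smooth_chart V \<phi> \<longleftrightarrow>
     open V \<and> open (\<phi> ` V) \<and> inj_on \<phi> V \<and> smooth_on V \<phi> \<and> smooth_on (\<phi> ` V) (inv_into V \<phi>)"

definition orthotoric_metric :: "(real \<Rightarrow> real) \<Rightarrow> (real \<Rightarrow> real) \<Rightarrow> R4 metric_tensor" where
  "orthotoric_metric F G = (\<lambda>(\<xi>, \<eta>, t, z) (d\<xi>, d\<eta>, dt, dz) (d\<xi>', d\<eta>', dt', dz').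
     (\<xi> - \<eta>) * (1 / F \<xi> * (d\<xi> * d\<xi>') - 1 / G \<eta> * (d\<eta> * d\<eta>'))
     + 1 / (\<xi> - \<eta>) * (F \<xi> * ((dt + \<eta> * dz) * (dt' + \<eta> * dz'))
                       - G \<eta> * ((dt + \<xi> * dz) * (dt' + \<xi> * dz'))))"

text \<open>Near every point of \<open>N\<close> there are coordinates \<open>(\<xi>,\<eta>,t,z)\<close>, with values in the region where the
  orthotoric expression is positive definite, in which \<open>g\<close> is the orthotoric metric of \<open>F, G\<close>.\<close>

definition locally_orthotoric ::
    "'a::euclidean_space set \<Rightarrow> 'a metric_tensor \<Rightarrow> (real \<Rightarrow> real) \<Rightarrow> (real \<Rightarrow> real) \<Rightarrow> bool" where
  "locally_orthotoric N g F G \<longleftrightarrow>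
     (\<forall>p\<in>N. \<exists>V \<phi>. p \<in> V \<and> V \<subseteq> N \<and> smooth_chart V \<phi> \<and>
        (\<forall>q\<in>V. (case \<phi> q of (\<xi>, \<eta>, t, z) \<Rightarrow> \<xi> > \<eta> \<and> F \<xi> > 0 \<and> G \<eta> < 0) \<and>
          (\<forall>X Y. g q X Y = orthotoric_metric F G (\<phi> q)
             (frechet_derivative \<phi> (at q) X) (frechet_derivative \<phi> (at q) Y))))"

definition orthotoric_type_kaehler_surface ::
    "'a::euclidean_space set \<Rightarrow> 'a metric_tensor \<Rightarrow> 'a endo_field \<Rightarrow> bool" where
  "orthotoric_type_kaehler_surface N g J \<longleftrightarrow>
     kaehler_surface N g J \<and> (\<exists>F G. locally_orthotoric N g F G)"

definition open_dense_in :: "'a::topological_space set \<Rightarrow> 'a set \<Rightarrow> bool" where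
  "open_dense_in U N \<longleftrightarrow> open U \<and> U \<subseteq> N \<and> N \<subseteq> closure U"

definition QCH_of_orthotoric_type ::
    "'a::euclidean_space set \<Rightarrow> 'a metric_tensor \<Rightarrow> 'a endo_field \<Rightarrow> bool" where
  "QCH_of_orthotoric_type N g J \<longleftrightarrow>
     QCH_kaehler_surface N g J \<and>
     (\<exists>U. open_dense_in U N \<and> orthotoric_type_kaehler_surface U g J)"

section \<open>The generalized Taub-NUT Kaehler surface\<close>

definition gtn_k :: "real \<Rightarrow> real \<Rightarrow> real" where
  "gtn_k \<alpha> \<beta> = (\<alpha> - \<beta>) / (\<alpha> + \<beta>)"

definition gtn_M :: "real \<Rightarrow> real \<Rightarrow> real" where
  "gtn_M \<alpha> \<beta> = (\<alpha> + \<beta>) / (2 * sqrt 2)"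

definition gtn_psi1 :: "real \<Rightarrow> real \<times> real \<Rightarrow> real" where
  "gtn_psi1 \<alpha> = (\<lambda>(x, y). 1 / sqrt 2 * (- y + sqrt (x\<^sup>2 + y\<^sup>2)) + \<alpha> / 2 * x\<^sup>2)"

definition gtn_psi2 :: "real \<Rightarrow> real \<times> real \<Rightarrow> real" where
  "gtn_psi2 \<beta> = (\<lambda>(x, y). 1 / sqrt 2 * (y + sqrt (x\<^sup>2 + y\<^sup>2)) + \<beta> / 2 * x\<^sup>2)"

definition gtn_gSigma :: "real \<Rightarrow> real \<Rightarrow> (real \<times> real) metric_tensor" where
  "gtn_gSigma \<alpha> \<beta> = (\<lambda>(x, y) (dx, dy) (dx', dy').
     (1 + 2 * gtn_M \<alpha> \<beta> * (gtn_k \<alpha> \<beta> * y + sqrt (x\<^sup>2 + y\<^sup>2))) / sqrt (x\<^sup>2 + y\<^sup>2)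
       * (dx * dx' + dy * dy'))"

definition gtn_gram ::
    "real \<Rightarrow> real \<Rightarrow> (real \<times> real \<Rightarrow> real) \<Rightarrow> (real \<times> real \<Rightarrow> real) \<Rightarrow> real \<times> real \<Rightarrow> real" where
  "gtn_gram \<alpha> \<beta> f h p =
     gtn_gSigma \<alpha> \<beta> p (grad (gtn_gSigma \<alpha> \<beta>) f p) (grad (gtn_gSigma \<alpha> \<beta>) h p)"

text \<open>The metric and the Kaehler form in the coordinates \<open>(x, y, \<theta>\<^sub>1, \<theta>\<^sub>2)\<close>, \<open>x > 0\<close>; the angles are
  lifted to the universal cover of the torus.\<close>

definition gtn_model_metric :: "real \<Rightarrow> real \<Rightarrow> R4 metric_tensor" where
  "gtn_model_metric \<alpha> \<beta> = (\<lambda>(x, y, \<theta>1, \<theta>2) (dx, dy, d\<theta>1, d\<theta>2) (dx', dy', d\<theta>1', d\<theta>2').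
     gtn_gSigma \<alpha> \<beta> (x, y) (dx, dy) (dx', dy')
     + gtn_gram \<alpha> \<beta> (gtn_psi1 \<alpha>) (gtn_psi1 \<alpha>) (x, y) * (d\<theta>1 * d\<theta>1')
     + gtn_gram \<alpha> \<beta> (gtn_psi1 \<alpha>) (gtn_psi2 \<beta>) (x, y) * (d\<theta>1 * d\<theta>2')
     + gtn_gram \<alpha> \<beta> (gtn_psi2 \<beta>) (gtn_psi1 \<alpha>) (x, y) * (d\<theta>2 * d\<theta>1')
     + gtn_gram \<alpha> \<beta> (gtn_psi2 \<beta>) (gtn_psi2 \<beta>) (x, y) * (d\<theta>2 * d\<theta>2'))"

definition gtn_model_form :: "real \<Rightarrow> real \<Rightarrow> R4 \<Rightarrow> R4 \<Rightarrow> R4 \<Rightarrow> real" where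
  "gtn_model_form \<alpha> \<beta> = (\<lambda>(x, y, \<theta>1, \<theta>2) (dx, dy, d\<theta>1, d\<theta>2) (dx', dy', d\<theta>1', d\<theta>2').
     let d\<psi>1 = frechet_derivative (gtn_psi1 \<alpha>) (at (x, y));
         d\<psi>2 = frechet_derivative (gtn_psi2 \<beta>) (at (x, y))
     in (d\<psi>1 (dx, dy) * d\<theta>1' - d\<psi>1 (dx', dy') * d\<theta>1)
      + (d\<psi>2 (dx, dy) * d\<theta>2' - d\<psi>2 (dx', dy') * d\<theta>2))"

text \<open>The covering \<open>(x, y, \<theta>\<^sub>1, \<theta>\<^sub>2) \<mapsto> (z\<^sub>1, z\<^sub>2)\<close> of \<open>(\<complex> - {0})\<^sup>2\<close> by \<open>{x > 0} \<times> \<real>\<^sup>2\<close>; its deck group is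
  generated by the translations of the angles by \<open>2 * sqrt 2 * pi\<close>.\<close>

definition gtn_cover :: "real \<Rightarrow> real \<Rightarrow> R4 \<Rightarrow> complex \<times> complex" where
  "gtn_cover \<alpha> \<beta> = (\<lambda>(x, y, \<theta>1, \<theta>2).
     let u = sqrt (gtn_M \<alpha> \<beta> * (sqrt (x\<^sup>2 + y\<^sup>2) + y));
         v = sqrt (gtn_M \<alpha> \<beta> * (sqrt (x\<^sup>2 + y\<^sup>2) - y))
     in (complex_of_real v * cis (\<theta>1 / sqrt 2), complex_of_real u * cis (\<theta>2 / sqrt 2)))"

text \<open>\<open>(\<complex>\<^sup>2, g, J)\<close> is the smooth extension of the structure \<open>(g, J)\<close> on \<open>(\<complex> - {0})\<^sup>2\<close>, \<open>J\<close> being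
  determined there by \<open>\<omega>(X,Y) = g(JX,Y)\<close>. By density of \<open>(\<complex> - {0})\<^sup>2\<close> such a pair is unique.\<close>

definition generalized_taub_nut ::
    "real \<Rightarrow> real \<Rightarrow> (complex \<times> complex) metric_tensor \<Rightarrow> (complex \<times> complex) endo_field \<Rightarrow> bool" where
  "generalized_taub_nut \<alpha> \<beta> g J \<longleftrightarrow>
     (\<forall>X Y. smooth_on UNIV (\<lambda>p. g p X Y)) \<and> (\<forall>X. smooth_on UNIV (\<lambda>p. J p X)) \<and>
     (\<forall>q::R4. fst q > 0 \<longrightarrow>
        (let \<Phi> = gtn_cover \<alpha> \<beta>; d\<Phi> = frechet_derivative \<Phi> (at q) in
         \<forall>X Y. g (\<Phi> q) (d\<Phi> X) (d\<Phi> Y) = gtn_model_metric \<alpha> \<beta> q X Y \<and>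
               g (\<Phi> q) (J (\<Phi> q) (d\<Phi> X)) (d\<Phi> Y) = gtn_model_form \<alpha> \<beta> q X Y))"

end

theory Submission
  imports Defs
begin

text \<open>Put \<open>A = 1 + k\<close>, \<open>B = 1 - k\<close> and \<open>c = 2 / M\<close>; the assumption on \<open>k\<close> says that \<open>A\<close> and \<open>B\<close> are positive.
  On the plane with coordinates \<open>z = (z1, z2)\<close> consider the function, the real 1-form and the vector field
  \<open>f = 1 + A * |z2|^2 + B * |z1|^2\<close>, \<open>\<kappa>(X) = Im (cnj z1 * X1) - Im (cnj z2 * X2)\<close>, \<open>V = (- i B z1, i A z2)\<close>,
  and the 1-form \<open>\<Theta>(X) = f * X + \<kappa>(X) * V\<close> with values in the plane itself. Since \<open>\<kappa>(V) = 1 - f\<close>, \<open>\<Theta>\<close> is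
  invertible everywhere, and \<open>\<kappa>(\<Theta>(X)) = \<kappa>(X)\<close> gives its inverse. The whole proof rests on the fact that the
  generalized Taub-NUT structure is \<open>g = (c / f) * |\<Theta>|^2\<close> and \<open>J = \<Theta>\<inverse> i \<Theta>\<close>. Where both coordinates are nonzero
  this is checked in the isothermal coordinates \<open>u = |z2|\<close>, \<open>v = |z1|\<close> of the half plane, in which all
  the data of the toric description are rational; by density and continuity it holds everywhere
  (\<open>generalized_taub_nut_eq\<close>).

  From here on everything is explicit and global. The Levi-Civita connection has the form
  \<open>\<Theta>(\<nabla>\<^sub>X Y) = D\<^sub>X(\<Theta> Y) + \<psi>(X) (\<Theta> Y)\<close> with a complex \<open>2 \<times> 2\<close> matrix \<open>\<psi>\<close> of 1-forms, polynomial up to the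
  factor \<open>1 / f^2\<close>: that it is torsion-free and metric are polynomial identities, and they determine it. As
  \<open>\<psi>\<close> commutes with \<open>i\<close>, \<open>J\<close> is parallel (\<open>kaehler\<close>). The curvature form \<open>d\<psi> + \<psi> \<and> \<psi>\<close>, evaluated on
  \<open>(X, JX)\<close>, turns out to be \<open>i\<close> times a Hermitian matrix built from \<open>|\<nu>|^2\<close>, \<open>|\<mu>|^2\<close> and \<open>\<nu> * cnj \<mu>\<close>, where \<open>(\<nu>, \<mu>) = \<Theta>(X)\<close>
  (\<open>curv_entries\<close>). Therefore the holomorphic curvature is a quadratic form in
  \<open>|\<nu>|^2\<close> and \<open>|\<mu>|^2\<close> with coefficients depending on the point (\<open>holomorphic_curvature\<close>). With \<open>D = ker \<nu>\<close> one has
  \<open>|X\<^sub>D|^2 = (c / f) * |\<mu>|^2\<close>, and \<open>|\<nu>|^2 + |\<mu>|^2 = f / c\<close> for a unit vector, which is the QCH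
  property (\<open>QCH\<close>). The form \<open>\<nu>\<close> has no zeros, so \<open>D\<close> is defined also on the axes and at the origin.

  Orthotoric coordinates exist off the axes: \<open>\<xi> = c A |z2|^2\<close> and \<open>\<eta> = - c (1 + B |z1|^2)\<close>, while \<open>t\<close>
  and \<open>z\<close> are linear combinations of the arguments of \<open>z1\<close> and \<open>z2\<close>. Then \<open>\<xi> - \<eta> = c f\<close>,
  \<open>F(\<xi>) = 4 c A \<xi>\<close> and \<open>G(\<eta>) = 4 c B \<eta> + 4 c^2 B\<close> (\<open>locally_orthotoric\<close>), from which the formulas for \<open>M\<close>
  and \<open>k\<close> can be read off.\<close>

section \<open>Smooth maps between Euclidean spaces\<close>

lemma frechet_derivative_eqI: "(f has_derivative f') (at p) \<Longrightarrow> frechet_derivative f (at p) = f'"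
  using frechet_derivative_at by metis

text \<open>On an open set the iterated derivatives only see the values there; this allows derivatives to be replaced by explicit
  formulas valid on the set.\<close>

lemma Ck_on_cong:
  assumes "open S" and "\<And>p. p \<in> S \<Longrightarrow> f p = h p"
  shows "Ck_on n S f \<longleftrightarrow> Ck_on n S h"
proof -
  have *: "Ck_on n S h" if "Ck_on n S f" "\<And>p. p \<in> S \<Longrightarrow> f p = h p" for f h :: "'a \<Rightarrow> 'b"
    using that
  proof (induction n arbitrary: f h)
    case 0
    then show ?case by (simp cong: continuous_on_cong)
  next
    case (Suc n)
    have D: "h differentiable (at p)" "frechet_derivative f (at p) = frechet_derivative h (at p)"
      if "p \<in> S" for p
    proof -
      have f: "(f has_derivative frechet_derivative f (at p)) (at p)"
        using Suc.prems(1) that frechet_derivative_works by auto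
      have "(h has_derivative frechet_derivative f (at p)) (at p)"
        by (rule has_derivative_transform_within_open[OF f assms(1) that]) (use Suc.prems(2) in auto)
      then show "h differentiable (at p)" "frechet_derivative f (at p) = frechet_derivative h (at p)"
        by (auto simp: differentiable_def frechet_derivative_eqI)
    qed
    have "Ck_on n S (\<lambda>p. frechet_derivative h (at p) v)" for v
      by (rule Suc.IH[of "\<lambda>p. frechet_derivative f (at p) v"]) (use Suc.prems D in auto)
    with D show ?case by simp
  qed
  show ?thesis using *[of f h] *[of h f] assms(2) by auto
qed

lemma Ck_on_SucI:
  assumes "open S" and "\<And>p. p \<in> S \<Longrightarrow> (f has_derivative f' p) (at p)"
    and "\<And>v. Ck_on n S (\<lambda>p. f' p v)"
  shows "Ck_on (Suc n) S f"
proof -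
  have "Ck_on n S (\<lambda>p. frechet_derivative f (at p) v)" for v
    using Ck_on_cong[OF assms(1), of "\<lambda>p. frechet_derivative f (at p) v" "\<lambda>p. f' p v"]
      frechet_derivative_eqI[OF assms(2)] assms(3) by auto
  then show ?thesis using assms(2) by (auto simp: differentiable_def)
qed

lemma Ck_on_SucD:
  assumes "Ck_on (Suc n) S f"
  shows "Ck_on n S f"
  using assms
proof (induction n arbitrary: f)
  case 0
  then show ?case
    by (auto intro!: continuous_at_imp_continuous_on differentiable_imp_continuous_within)
next
  case (Suc n)
  then show ?case using Suc.IH by (auto simp del: Ck_on.simps(1))
qed

lemma Ck_on_subset: "Ck_on n T f \<Longrightarrow> S \<subseteq> T \<Longrightarrow> Ck_on n S f"
  by (induction n arbitrary: f) (auto intro: continuous_on_subset)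

lemma Ck_on_has_derivative:
  "Ck_on (Suc n) S f \<Longrightarrow> p \<in> S \<Longrightarrow> (f has_derivative frechet_derivative f (at p)) (at p)"
  by (auto simp: frechet_derivative_works)

lemma Ck_on_const: "Ck_on n S (\<lambda>_. c)"
  by (induction n arbitrary: c) auto

lemma Ck_on_bounded_linear:
  assumes "open S" and L: "bounded_linear L" and "Ck_on n S f"
  shows "Ck_on n S (\<lambda>p. L (f p))"
  using assms(3)
proof (induction n arbitrary: f)
  case 0
  then show ?case by (simp add: bounded_linear.continuous_on[OF L])
next
  case (Suc n)
  show ?case
  proof (rule Ck_on_SucI[OF assms(1)])
    show "((\<lambda>p. L (f p)) has_derivative (\<lambda>v. L (frechet_derivative f (at p) v))) (at p)"
      if "p \<in> S" for p
      by (rule bounded_linear.has_derivative[OF L Ck_on_has_derivative[OF Suc.prems that]])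
    show "Ck_on n S (\<lambda>p. L (frechet_derivative f (at p) v))" for v
      by (rule Suc.IH) (use Suc.prems in auto)
  qed
qed

lemma Ck_on_add:
  assumes "open S" and "Ck_on n S f" "Ck_on n S h"
  shows "Ck_on n S (\<lambda>p. f p + h p)"
  using assms(2,3)
proof (induction n arbitrary: f h)
  case 0
  then show ?case by (simp add: continuous_on_add)
next
  case (Suc n)
  show ?case
  proof (rule Ck_on_SucI[OF assms(1)])
    show "((\<lambda>p. f p + h p) has_derivative
        (\<lambda>v. frechet_derivative f (at p) v + frechet_derivative h (at p) v)) (at p)" if "p \<in> S" for p
      using that Ck_on_has_derivative[OF Suc.prems(1)] Ck_on_has_derivative[OF Suc.prems(2)]
      by (intro has_derivative_add) auto
    show "Ck_on n S (\<lambda>p. frechet_derivative f (at p) v + frechet_derivative h (at p) v)" for v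
      by (rule Suc.IH) (use Suc.prems in auto)
  qed
qed

lemma Ck_on_bounded_bilinear:
  assumes "open S" and B: "bounded_bilinear B" and "Ck_on n S f" "Ck_on n S h"
  shows "Ck_on n S (\<lambda>p. B (f p) (h p))"
  using assms(3,4)
proof (induction n arbitrary: f h)
  case 0
  then show ?case by (simp add: bounded_bilinear.continuous_on[OF B])
next
  case (Suc n)
  show ?case
  proof (rule Ck_on_SucI[OF assms(1)])
    show "((\<lambda>p. B (f p) (h p)) has_derivative
        (\<lambda>v. B (f p) (frechet_derivative h (at p) v) + B (frechet_derivative f (at p) v) (h p))) (at p)"
      if "p \<in> S" for p
      using that Ck_on_has_derivative[OF Suc.prems(1)] Ck_on_has_derivative[OF Suc.prems(2)]
      by (intro bounded_bilinear.FDERIV[OF B]) auto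
    show "Ck_on n S (\<lambda>p. B (f p) (frechet_derivative h (at p) v) + B (frechet_derivative f (at p) v) (h p))" for v
      by (intro Ck_on_add Suc.IH assms(1) Ck_on_SucD[OF Suc.prems(1)] Ck_on_SucD[OF Suc.prems(2)])
        (use Suc.prems in auto)
  qed
qed

lemma Ck_on_Pair:
  assumes "open S" and "Ck_on n S f" "Ck_on n S h"
  shows "Ck_on n S (\<lambda>p. (f p, h p))"
proof -
  have "Ck_on n S (\<lambda>p. (f p, 0) + (0, h p))"
    by (intro Ck_on_add Ck_on_bounded_linear[where L="\<lambda>x. (x, 0)"]
          Ck_on_bounded_linear[where L="\<lambda>x. (0, x)"] assms bounded_linear_Pair
          bounded_linear_ident bounded_linear_zero)
  then show ?thesis by simp
qed

text \<open>If the derivative of \<open>F\<close> along \<open>h\<close> is expressed through \<open>F \<circ> h\<close> itself, by an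
  operation \<open>G\<close> that preserves differentiability, then induction on the order works without a higher chain rule.
  The exponential, the reciprocal, the logarithm and the square root are all of this kind.\<close>

lemma Ck_on_compose_ode:
  assumes "open S"
    and D: "\<And>p. p \<in> S \<Longrightarrow> (F has_field_derivative G p (F (h p))) (at (h p))"
    and G: "\<And>n f. Ck_on n S h \<Longrightarrow> Ck_on n S f \<Longrightarrow> Ck_on n S (\<lambda>p. G p (f p))"
    and "Ck_on n S h"
  shows "Ck_on n S (\<lambda>p. F (h p))"
  using assms(4)
proof (induction n)
  case 0
  have "continuous (at x within S) (\<lambda>p. F (h p))" if "x \<in> S" for x
    using 0 D[OF that] that
    by (intro continuous_within_compose3[where g=F and f=h])
       (auto simp: continuous_on_eq_continuous_within DERIV_isCont)
  then show ?case by (simp add: continuous_on_eq_continuous_within)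
next
  case (Suc n)
  show ?case
  proof (rule Ck_on_SucI[OF assms(1)])
    show "((\<lambda>p. F (h p)) has_derivative (\<lambda>v. frechet_derivative h (at p) v * G p (F (h p)))) (at p)"
      if "p \<in> S" for p
      using has_derivative_compose[OF Ck_on_has_derivative[OF Suc.prems that],
          of F "(*) (G p (F (h p)))"] D[OF that]
      by (simp add: has_field_derivative_def mult.commute)
    show "Ck_on n S (\<lambda>p. frechet_derivative h (at p) v * G p (F (h p)))" for v
      using Suc.prems Ck_on_SucD[OF Suc.prems] Suc.IH
      by (intro Ck_on_bounded_bilinear[OF assms(1) bounded_bilinear_mult] G) auto
  qed
qed

lemma Ck_on_exp:
  assumes "open S" "Ck_on n S h"
  shows "Ck_on n S (\<lambda>p. exp (h p :: 'b :: {real_normed_field, banach}))"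
  by (rule Ck_on_compose_ode[where F=exp and G="\<lambda>p y. y"]) (use assms DERIV_exp in auto)

lemma Ck_on_inverse:
  assumes "open S" "Ck_on n S h" "\<And>p. p \<in> S \<Longrightarrow> h p \<noteq> 0"
  shows "Ck_on n S (\<lambda>p. inverse (h p :: 'b :: real_normed_field))"
  by (rule Ck_on_compose_ode[where F=inverse and G="\<lambda>p y. - (y * y)"])
     (use assms in \<open>auto intro!: derivative_eq_intros Ck_on_bounded_linear[OF _ bounded_linear_minus[OF bounded_linear_ident]]
        Ck_on_bounded_bilinear[OF _ bounded_bilinear_mult] simp: power2_eq_square\<close>)

lemma Ck_on_Ln:
  assumes "open S" "Ck_on n S h" "\<And>p. p \<in> S \<Longrightarrow> h p \<notin> \<real>\<^sub>\<le>\<^sub>0"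
  shows "Ck_on n S (\<lambda>p. Ln (h p))"
proof (rule Ck_on_compose_ode[where F=Ln and G="\<lambda>p y. inverse (h p)"])
  show "(Ln has_field_derivative inverse (h p)) (at (h p))" if "p \<in> S" for p
    using assms(3)[OF that] by (rule has_field_derivative_Ln)
  have "h p \<noteq> 0" if "p \<in> S" for p using assms(3)[OF that] by auto
  then show "Ck_on n S (\<lambda>p. inverse (h p))" if "Ck_on n S h" for n
    using Ck_on_inverse[OF assms(1) that] by auto
qed (use assms in auto)

lemma Ck_on_sqrt:
  assumes "open S" "Ck_on n S h" "\<And>p. p \<in> S \<Longrightarrow> h p > 0"
  shows "Ck_on n S (\<lambda>p. sqrt (h p))"
proof (rule Ck_on_compose_ode[where F=sqrt and G="\<lambda>p y. y * (1/2 * inverse (h p))"])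
  show "(sqrt has_field_derivative sqrt (h p) * (1/2 * inverse (h p))) (at (h p))" if "p \<in> S" for p
    using assms(3)[OF that]
    by (auto intro!: derivative_eq_intros simp: field_simps)
  show "Ck_on n S (\<lambda>p. f p * (1/2 * inverse (h p)))" if "Ck_on n S h" "Ck_on n S f" for n f
    using assms(1,3) that Ck_on_inverse[OF assms(1) that(1)]
    by (intro Ck_on_bounded_bilinear[OF _ bounded_bilinear_mult] Ck_on_const) force+
qed (use assms in auto)

lemma smooth_on_cong: "open S \<Longrightarrow> (\<And>p. p \<in> S \<Longrightarrow> f p = h p) \<Longrightarrow> smooth_on S f \<longleftrightarrow> smooth_on S h"
  unfolding smooth_on_def using Ck_on_cong[of S f h] by auto

lemma smooth_on_subset: "smooth_on T f \<Longrightarrow> S \<subseteq> T \<Longrightarrow> smooth_on S f"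
  unfolding smooth_on_def by (blast intro: Ck_on_subset)

lemma smooth_on_imp_continuous_on: "smooth_on S f \<Longrightarrow> continuous_on S f"
  unfolding smooth_on_def by (metis Ck_on.simps(1))

lemma smooth_on_const [intro]: "smooth_on S (\<lambda>_. c)"
  by (auto simp: smooth_on_def Ck_on_const)

lemma smooth_on_bounded_linear:
  "open S \<Longrightarrow> bounded_linear L \<Longrightarrow> smooth_on S f \<Longrightarrow> smooth_on S (\<lambda>p. L (f p))"
  unfolding smooth_on_def by (blast intro: Ck_on_bounded_linear)

lemma smooth_on_add: "open S \<Longrightarrow> smooth_on S f \<Longrightarrow> smooth_on S h \<Longrightarrow> smooth_on S (\<lambda>p. f p + h p)"
  unfolding smooth_on_def by (blast intro: Ck_on_add)

lemma smooth_on_Pair: "open S \<Longrightarrow> smooth_on S f \<Longrightarrow> smooth_on S h \<Longrightarrow> smooth_on S (\<lambda>p. (f p, h p))"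
  unfolding smooth_on_def by (blast intro: Ck_on_Pair)

lemma smooth_on_bounded_bilinear:
  "open S \<Longrightarrow> bounded_bilinear B \<Longrightarrow> smooth_on S f \<Longrightarrow> smooth_on S h \<Longrightarrow> smooth_on S (\<lambda>p. B (f p) (h p))"
  unfolding smooth_on_def by (blast intro: Ck_on_bounded_bilinear)

lemmas smooth_on_mult = smooth_on_bounded_bilinear[OF _ bounded_bilinear_mult]

lemma smooth_on_ident: "open S \<Longrightarrow> smooth_on S (\<lambda>p. p)"
proof -
  assume S: "open S"
  have "Ck_on n S (\<lambda>p. p)" for n
  proof (cases n)
    case (Suc m)
    have "Ck_on (Suc m) S (\<lambda>p. p)"
      by (rule Ck_on_SucI[OF S, of _ "\<lambda>p v. v"]) (auto intro: Ck_on_const)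
    then show ?thesis using Suc by simp
  qed auto
  then show ?thesis by (simp add: smooth_on_def)
qed

lemma smooth_on_exp:
  "open S \<Longrightarrow> smooth_on S h \<Longrightarrow> smooth_on S (\<lambda>p. exp (h p :: 'b :: {real_normed_field, banach}))"
  unfolding smooth_on_def by (blast intro: Ck_on_exp)

lemma smooth_on_Ln:
  "open S \<Longrightarrow> smooth_on S h \<Longrightarrow> (\<And>p. p \<in> S \<Longrightarrow> h p \<notin> \<real>\<^sub>\<le>\<^sub>0) \<Longrightarrow> smooth_on S (\<lambda>p. Ln (h p))"
  unfolding smooth_on_def by (blast intro: Ck_on_Ln)

lemma smooth_on_sqrt:
  "open S \<Longrightarrow> smooth_on S h \<Longrightarrow> (\<And>p. p \<in> S \<Longrightarrow> h p > 0) \<Longrightarrow> smooth_on S (\<lambda>p. sqrt (h p))"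
  unfolding smooth_on_def by (blast intro: Ck_on_sqrt)

lemma smooth_on_inverse:
  "open S \<Longrightarrow> smooth_on S h \<Longrightarrow> (\<And>p. p \<in> S \<Longrightarrow> h p \<noteq> 0) \<Longrightarrow> smooth_on S (\<lambda>p. inverse (h p :: 'b :: real_normed_field))"
  unfolding smooth_on_def by (blast intro: Ck_on_inverse)

lemmas smooth_on_Re = smooth_on_bounded_linear[OF _ bounded_linear_Re]
  and smooth_on_Im = smooth_on_bounded_linear[OF _ bounded_linear_Im]
  and smooth_on_fst = smooth_on_bounded_linear[OF _ bounded_linear_fst]
  and smooth_on_snd = smooth_on_bounded_linear[OF _ bounded_linear_snd]
  and smooth_on_of_real = smooth_on_bounded_linear[OF _ bounded_linear_of_real]
  and smooth_on_minus = smooth_on_bounded_linear[OF _ bounded_linear_minus[OF bounded_linear_ident]]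

lemma smooth_on_diff:
  "open S \<Longrightarrow> smooth_on S f \<Longrightarrow> smooth_on S h \<Longrightarrow> smooth_on S (\<lambda>p. f p - h p)"
  unfolding diff_conv_add_uminus by (intro smooth_on_add smooth_on_minus)

text \<open>A chart is most easily given together with an explicit smooth inverse.\<close>

lemma smooth_chartI:
  assumes "open V" "open W" "smooth_on V \<phi>" "smooth_on W \<rho>"
    and V: "\<And>q. q \<in> V \<Longrightarrow> \<phi> q \<in> W \<and> \<rho> (\<phi> q) = q"
    and W: "\<And>w. w \<in> W \<Longrightarrow> \<rho> w \<in> V \<and> \<phi> (\<rho> w) = w"
  shows "smooth_chart V \<phi>"
proof -
  have img: "\<phi> ` V = W" using V W by force
  have inj: "inj_on \<phi> V" using V by (metis inj_onI)
  have "inv_into V \<phi> w = \<rho> w" if "w \<in> W" for w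
    using W[OF that] inj by (metis inv_into_f_f)
  then have "smooth_on W (inv_into V \<phi>)"
    using smooth_on_cong[OF \<open>open W\<close>, of "inv_into V \<phi>" \<rho>] assms(4) by simp
  then show ?thesis
    using assms(1-3) img inj by (simp add: smooth_chart_def)
qed

section \<open>Levi-Civita connection and curvature in a conformal coframe\<close>

lemma kaehler_surface_open_subset:
  assumes "kaehler_surface N g J" "open U" "U \<subseteq> N"
  shows "kaehler_surface U g J"
  using assms unfolding kaehler_surface_def riemannian_metric_on_def
  by (auto intro!: smooth_on_subset[where T=N and S=U])

text \<open>Product rule for the evaluation of a point-dependent linear map; only the derivatives at fixed arguments are required because
  a linear map on a Euclidean space is determined by a basis.\<close>

lemma has_derivative_linear_family:
  fixes L :: "'a::real_normed_vector \<Rightarrow> 'b::euclidean_space \<Rightarrow> 'c::real_normed_vector"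
  assumes L: "\<And>w. ((\<lambda>q. L q w) has_derivative (\<lambda>X. L' X w)) (at p)"
    and lin: "\<And>q. linear (L q)"
    and h: "(h has_derivative h') (at p)"
  shows "((\<lambda>q. L q (h q)) has_derivative (\<lambda>X. L' X (h p) + L p (h' X))) (at p)"
proof -
  have exp: "L q w = (\<Sum>b\<in>Basis. (w \<bullet> b) *\<^sub>R L q b)" for q w
  proof -
    have "L q w = L q (\<Sum>b\<in>Basis. (w \<bullet> b) *\<^sub>R b)"
      by (simp add: euclidean_representation)
    also have "\<dots> = (\<Sum>b\<in>Basis. (w \<bullet> b) *\<^sub>R L q b)"
      by (simp add: linear_sum[OF lin] linear_cmul[OF lin])
    finally show ?thesis .
  qed
  have "((\<lambda>q. \<Sum>b\<in>Basis. (w \<bullet> b) *\<^sub>R L q b) has_derivative (\<lambda>X. \<Sum>b\<in>Basis. (w \<bullet> b) *\<^sub>R L' X b)) (at p)" for w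
    by (intro has_derivative_sum has_derivative_scaleR_right L)
  then have "((\<lambda>q. L q w) has_derivative (\<lambda>X. \<Sum>b\<in>Basis. (w \<bullet> b) *\<^sub>R L' X b)) (at p)" for w
    unfolding exp[of _ w] .
  from has_derivative_unique[OF L this]
  have exp': "L' X w = (\<Sum>b\<in>Basis. (w \<bullet> b) *\<^sub>R L' X b)" for X w
    by (rule fun_cong)
  have "((\<lambda>q. \<Sum>b\<in>Basis. (h q \<bullet> b) *\<^sub>R L q b) has_derivative
      (\<lambda>X. \<Sum>b\<in>Basis. (h p \<bullet> b) *\<^sub>R L' X b + (h' X \<bullet> b) *\<^sub>R L p b)) (at p)"
    by (intro has_derivative_sum has_derivative_scaleR has_derivative_inner_left L h)
  then have "((\<lambda>q. L q (h q)) has_derivative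
      (\<lambda>X. \<Sum>b\<in>Basis. (h p \<bullet> b) *\<^sub>R L' X b + (h' X \<bullet> b) *\<^sub>R L p b)) (at p)"
    unfolding exp[of _ "h _"] .
  then show ?thesis
    unfolding sum.distrib exp[of p "h' _"] exp'[of _ "h p"] .
qed

text \<open>The metric is \<open>s\<close> times the pull-back of a Euclidean inner product under an invertible vector-valued 1-form
  \<open>\<Theta>\<close>. Here \<open>\<Theta>' p X Y\<close> is the derivative of \<open>\<Theta> Y\<close> in direction
  \<open>X\<close>, for constant \<open>Y\<close>, and \<open>\<psi>\<close> is a candidate for the matrix of connection forms.
  The conditions \<open>torsion_free\<close> and \<open>metric_compatible\<close> are Cartan's characterization of the
  Levi-Civita connection, so verifying them replaces inverting the metric. Keeping the factor \<open>s\<close> separate avoids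
  the square root in a normalized coframe.\<close>

locale conformal_coframe =
  fixes g :: "'a::euclidean_space metric_tensor" and s :: "'a \<Rightarrow> real" and s' :: "'a \<Rightarrow> 'a \<Rightarrow> real"
    and \<Theta> :: "'a \<Rightarrow> 'a \<Rightarrow> 'b::euclidean_space" and \<Theta>' :: "'a \<Rightarrow> 'a \<Rightarrow> 'a \<Rightarrow> 'b"
    and \<Theta>i :: "'a \<Rightarrow> 'b \<Rightarrow> 'a" and \<psi> :: "'a \<Rightarrow> 'a \<Rightarrow> 'b \<Rightarrow> 'b"
  assumes g_eq: "g p X Y = s p * (\<Theta> p X \<bullet> \<Theta> p Y)"
    and s_pos: "s p > 0"
    and s_deriv: "(s has_derivative s' p) (at p)"
    and \<Theta>_lin: "linear (\<Theta> p)"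
    and \<Theta>_inv: "\<Theta> p (\<Theta>i p w) = w"
    and \<Theta>i_\<Theta>: "\<Theta>i p (\<Theta> p X) = X"
    and \<Theta>_deriv: "((\<lambda>q. \<Theta> q Y) has_derivative (\<lambda>X. \<Theta>' p X Y)) (at p)"
    and \<Theta>i_diff: "(\<lambda>q. \<Theta>i q w) differentiable (at p)"
    and torsion_free: "\<Theta>' p X Y + \<psi> p X (\<Theta> p Y) = \<Theta>' p Y X + \<psi> p Y (\<Theta> p X)"
    and metric_compatible: "s p * (\<psi> p X a \<bullet> b + a \<bullet> \<psi> p X b) = s' p X * (a \<bullet> b)"
begin

lemma \<Theta>i_lin: "linear (\<Theta>i p)"
proof
  fix v w :: 'b and r :: real
  have "\<Theta> p (\<Theta>i p v + \<Theta>i p w) = v + w" "\<Theta> p (r *\<^sub>R \<Theta>i p w) = r *\<^sub>R w"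
    by (simp_all add: linear_add[OF \<Theta>_lin] linear_cmul[OF \<Theta>_lin] \<Theta>_inv)
  from this[symmetric] show "\<Theta>i p (v + w) = \<Theta>i p v + \<Theta>i p w" "\<Theta>i p (r *\<^sub>R w) = r *\<^sub>R \<Theta>i p w"
    by (simp_all add: \<Theta>i_\<Theta>)
qed

lemma \<Theta>_eq_iff: "\<Theta> p X = w \<longleftrightarrow> X = \<Theta>i p w"
  by (auto simp: \<Theta>_inv \<Theta>i_\<Theta>)

lemma \<Theta>_eq_0_iff: "\<Theta> p X = 0 \<longleftrightarrow> X = 0"
  by (auto simp: \<Theta>_eq_iff linear_0[OF \<Theta>i_lin])

lemma metric_bilinear: "bilinear (g p)"
  unfolding bilinear_def g_eq
  by (auto intro!: linearI simp: linear_add[OF \<Theta>_lin] linear_cmul[OF \<Theta>_lin] inner_simps algebra_simps)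

lemma metric_pos: "X \<noteq> 0 \<Longrightarrow> g p X X > 0"
  using \<Theta>_eq_0_iff s_pos by (simp add: g_eq)

lemma metric_nondegenerate:
  assumes "\<And>Z. g p V Z = g p W Z"
  shows "V = W"
proof -
  have "s p * ((\<Theta> p V - \<Theta> p W) \<bullet> \<Theta> p (V - W)) = 0"
    using assms[of "V - W"] by (simp add: g_eq inner_diff_left algebra_simps)
  then have "\<Theta> p (V - W) = 0"
    using s_pos[of p] by (simp add: linear_diff[OF \<Theta>_lin])
  then show ?thesis by (simp add: \<Theta>_eq_0_iff)
qed

lemma metric_deriv:
  "((\<lambda>q. g q Y Z) has_derivative
     (\<lambda>X. s p * ((\<Theta>' p X Y + \<psi> p X (\<Theta> p Y)) \<bullet> \<Theta> p Z + \<Theta> p Y \<bullet> (\<Theta>' p X Z + \<psi> p X (\<Theta> p Z))))) (at p)"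
proof -
  have "((\<lambda>q. g q Y Z) has_derivative
     (\<lambda>X. s p * (\<Theta> p Y \<bullet> \<Theta>' p X Z + \<Theta>' p X Y \<bullet> \<Theta> p Z) + s' p X * (\<Theta> p Y \<bullet> \<Theta> p Z))) (at p)"
    unfolding g_eq by (intro has_derivative_mult has_derivative_inner s_deriv \<Theta>_deriv)
  moreover have "s p * (\<Theta> p Y \<bullet> \<Theta>' p X Z + \<Theta>' p X Y \<bullet> \<Theta> p Z) + s' p X * (\<Theta> p Y \<bullet> \<Theta> p Z) =
      s p * ((\<Theta>' p X Y + \<psi> p X (\<Theta> p Y)) \<bullet> \<Theta> p Z + \<Theta> p Y \<bullet> (\<Theta>' p X Z + \<psi> p X (\<Theta> p Z)))" for X
    unfolding metric_compatible[symmetric] by (simp add: inner_simps algebra_simps)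
  ultimately show ?thesis by simp
qed

text \<open>By torsion-freeness and compatibility the three terms of the Koszul formula combine to twice the connection.\<close>

lemma christoffel_eq: "christoffel g p X Y = \<Theta>i p (\<Theta>' p X Y + \<psi> p X (\<Theta> p Y))"
  unfolding christoffel_def
proof (rule the_equality)
  let ?\<Gamma> = "\<lambda>X Y. \<Theta>' p X Y + \<psi> p X (\<Theta> p Y)"
  have D: "frechet_derivative (\<lambda>q. g q Y Z) (at p) X = s p * (?\<Gamma> X Y \<bullet> \<Theta> p Z + \<Theta> p Y \<bullet> ?\<Gamma> X Z)" for X Y Z
    by (simp add: frechet_derivative_eqI[OF metric_deriv])
  have *: "2 * g p (\<Theta>i p (?\<Gamma> X Y)) Z = frechet_derivative (\<lambda>q. g q Y Z) (at p) X
      + frechet_derivative (\<lambda>q. g q X Z) (at p) Y - frechet_derivative (\<lambda>q. g q X Y) (at p) Z" for Z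
    unfolding D
    unfolding g_eq \<Theta>_inv torsion_free[of p X Y] torsion_free[of p X Z] torsion_free[of p Y Z]
    by (simp add: inner_commute algebra_simps)
  then show "\<forall>Z. 2 * g p (\<Theta>i p (?\<Gamma> X Y)) Z = frechet_derivative (\<lambda>q. g q Y Z) (at p) X
      + frechet_derivative (\<lambda>q. g q X Z) (at p) Y - frechet_derivative (\<lambda>q. g q X Y) (at p) Z" by blast
  fix V
  assume V: "\<forall>Z. 2 * g p V Z = frechet_derivative (\<lambda>q. g q Y Z) (at p) X
      + frechet_derivative (\<lambda>q. g q X Z) (at p) Y - frechet_derivative (\<lambda>q. g q X Y) (at p) Z"
  show "V = \<Theta>i p (?\<Gamma> X Y)"
    by (rule metric_nondegenerate[of p])
      (use trans[OF spec[OF V] *[symmetric]] in simp)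
qed

text \<open>In the coframe the covariant derivative is the ordinary derivative plus the connection form.\<close>

lemma coframe_cov_deriv:
  assumes "V differentiable (at p)"
    and W: "((\<lambda>q. \<Theta> q (V q)) has_derivative W') (at p)"
  shows "\<Theta> p (cov_deriv g (\<lambda>_. X) V p) = W' X + \<psi> p X (\<Theta> p (V p))"
proof -
  let ?V' = "frechet_derivative V (at p)"
  have "(V has_derivative ?V') (at p)"
    using assms(1) by (simp add: frechet_derivative_works)
  then have "((\<lambda>q. \<Theta> q (V q)) has_derivative (\<lambda>X. \<Theta>' p X (V p) + \<Theta> p (?V' X))) (at p)"
    by (intro has_derivative_linear_family \<Theta>_deriv \<Theta>_lin)
  then have "W' X = \<Theta>' p X (V p) + \<Theta> p (?V' X)"
    using W has_derivative_unique by metis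
  then show ?thesis
    by (simp add: cov_deriv_def christoffel_eq linear_add[OF \<Theta>_lin] \<Theta>_inv)
qed

lemma differentiable_\<Theta>i_comp:
  assumes "W differentiable (at p)"
  shows "(\<lambda>q. \<Theta>i q (W q)) differentiable (at p)"
proof -
  obtain W' where W': "(W has_derivative W') (at p)"
    using assms unfolding differentiable_def by blast
  have "((\<lambda>q. \<Theta>i q w) has_derivative (\<lambda>X. frechet_derivative (\<lambda>q. \<Theta>i q w) (at p) X)) (at p)" for w
    using \<Theta>i_diff by (simp add: frechet_derivative_works)
  from has_derivative_linear_family[OF this \<Theta>i_lin W'] show ?thesis
    by (rule differentiableI)
qed

text \<open>An endomorphism with constant coefficients in the coframe is parallel as soon as the connection form commutes with it.\<close>

lemma parallel_endomorphism:
  assumes J: "\<And>q Y. J q Y = \<Theta>i q (I (\<Theta> q Y))"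
    and I: "bounded_linear I" and comm: "\<And>p X a. \<psi> p X (I a) = I (\<psi> p X a)"
  shows "cov_deriv g (\<lambda>_. X) (\<lambda>q. J q Y) p = J p (cov_deriv g (\<lambda>_. X) (\<lambda>_. Y) p)"
proof -
  have D: "((\<lambda>q. I (\<Theta> q Y)) has_derivative (\<lambda>X. I (\<Theta>' p X Y))) (at p)"
    by (rule bounded_linear.has_derivative[OF I \<Theta>_deriv])
  have "\<Theta> p (cov_deriv g (\<lambda>_. X) (\<lambda>q. J q Y) p) = I (\<Theta>' p X Y) + \<psi> p X (\<Theta> p (J p Y))"
  proof (rule coframe_cov_deriv)
    show "(\<lambda>q. J q Y) differentiable (at p)"
      unfolding J by (rule differentiable_\<Theta>i_comp[OF differentiableI[OF D]])
    show "((\<lambda>q. \<Theta> q (J q Y)) has_derivative (\<lambda>X. I (\<Theta>' p X Y))) (at p)"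
      unfolding J \<Theta>_inv by (rule D)
  qed
  also have "\<dots> = I (\<Theta> p (cov_deriv g (\<lambda>_. X) (\<lambda>_. Y) p))"
    using coframe_cov_deriv[OF differentiable_const \<Theta>_deriv]
    by (simp add: J \<Theta>_inv comm linear_add[OF bounded_linear.linear[OF I]])
  finally show ?thesis
    by (simp add: J \<Theta>_eq_iff)
qed

end

text \<open>Second-order data: the derivative of the connection form and the second derivative of \<open>\<Theta>\<close>, whose symmetry
  makes it drop out of the curvature.\<close>

locale conformal_coframe2 = conformal_coframe g s s' \<Theta> \<Theta>' \<Theta>i \<psi>
  for g :: "'a::euclidean_space metric_tensor" and s s' and \<Theta> :: "'a \<Rightarrow> 'a \<Rightarrow> 'b::euclidean_space"
    and \<Theta>' \<Theta>i \<psi> +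
  fixes \<Theta>'' :: "'a \<Rightarrow> 'a \<Rightarrow> 'a \<Rightarrow> 'a \<Rightarrow> 'b" and \<psi>' :: "'a \<Rightarrow> 'a \<Rightarrow> 'a \<Rightarrow> 'b \<Rightarrow> 'b"
  assumes \<psi>_lin: "linear (\<psi> p X)"
    and \<psi>_deriv: "((\<lambda>q. \<psi> q Y a) has_derivative (\<lambda>X. \<psi>' p X Y a)) (at p)"
    and \<Theta>'_deriv: "((\<lambda>q. \<Theta>' q Y Z) has_derivative (\<lambda>X. \<Theta>'' p X Y Z)) (at p)"
    and \<Theta>''_sym: "\<Theta>'' p X Y Z = \<Theta>'' p Y X Z"
begin

text \<open>The curvature form \<open>d\<psi> + \<psi> \<and> \<psi>\<close>, evaluated on constant vector fields.\<close>

definition curv_form :: "'a \<Rightarrow> 'a \<Rightarrow> 'a \<Rightarrow> 'b \<Rightarrow> 'b" where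
  "curv_form p X Y a = \<psi>' p X Y a - \<psi>' p Y X a + \<psi> p X (\<psi> p Y a) - \<psi> p Y (\<psi> p X a)"

lemma coframe_cov_deriv2:
  "\<Theta> p (cov_deriv g (\<lambda>_. X) (cov_deriv g (\<lambda>_. Y) (\<lambda>_. Z)) p) =
     \<Theta>'' p X Y Z + (\<psi>' p X Y (\<Theta> p Z) + \<psi> p Y (\<Theta>' p X Z)) +
     \<psi> p X (\<Theta>' p Y Z + \<psi> p Y (\<Theta> p Z))"
proof -
  let ?C = "\<lambda>q. \<Theta>' q Y Z + \<psi> q Y (\<Theta> q Z)"
  have eq: "cov_deriv g (\<lambda>_. Y) (\<lambda>_. Z) = (\<lambda>q. \<Theta>i q (?C q))"
    using coframe_cov_deriv[OF differentiable_const \<Theta>_deriv] unfolding \<Theta>_eq_iff by (intro ext)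
  have D: "(?C has_derivative (\<lambda>X. \<Theta>'' p X Y Z + (\<psi>' p X Y (\<Theta> p Z) + \<psi> p Y (\<Theta>' p X Z)))) (at p)"
    by (intro has_derivative_add \<Theta>'_deriv has_derivative_linear_family \<psi>_deriv \<psi>_lin \<Theta>_deriv)
  have "\<Theta> p (cov_deriv g (\<lambda>_. X) (\<lambda>q. \<Theta>i q (?C q)) p) =
      \<Theta>'' p X Y Z + (\<psi>' p X Y (\<Theta> p Z) + \<psi> p Y (\<Theta>' p X Z)) + \<psi> p X (\<Theta> p (\<Theta>i p (?C p)))"
    by (rule coframe_cov_deriv)
       (use D differentiable_\<Theta>i_comp[OF differentiableI[OF D]] in \<open>simp_all add: \<Theta>_inv\<close>)
  then show ?thesis by (simp add: eq \<Theta>_inv)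
qed

theorem riemann_curv_eq: "riemann_curv g p X Y Z W = s p * (curv_form p X Y (\<Theta> p Z) \<bullet> \<Theta> p W)"
proof -
  have "\<Theta> p (cov_deriv g (\<lambda>_. X) (cov_deriv g (\<lambda>_. Y) (\<lambda>_. Z)) p
      - cov_deriv g (\<lambda>_. Y) (cov_deriv g (\<lambda>_. X) (\<lambda>_. Z)) p) = curv_form p X Y (\<Theta> p Z)"
    unfolding linear_diff[OF \<Theta>_lin] coframe_cov_deriv2 curv_form_def linear_add[OF \<psi>_lin]
      \<Theta>''_sym[of p Y X] by simp
  then show ?thesis by (simp add: riemann_curv_def g_eq)
qed

end

section \<open>A global complex coframe on the plane\<close>

type_synonym C2 = "complex \<times> complex"

text \<open>The parameters stand for \<open>A = 1 + k\<close>, \<open>B = 1 - k\<close> and \<open>c = 2 / M\<close>.\<close>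

locale taub_nut =
  fixes A B c :: real
  assumes A_pos: "A > 0" and B_pos: "B > 0" and c_pos: "c > 0"
begin

text \<open>Half the differential of the conformal factor \<open>f\<close> below; as \<open>f\<close> is quadratic this is a symmetric
  bilinear form, whose value on the diagonal is \<open>f - 1\<close>.\<close>

definition half_df :: "C2 \<Rightarrow> C2 \<Rightarrow> real" where
  "half_df z X = A * Re (cnj (snd z) * snd X) + B * Re (cnj (fst z) * fst X)"

text \<open>The 1-form \<open>|z1|\<^sup>2 d arg z1 - |z2|\<^sup>2 d arg z2\<close>.\<close>

definition kappa :: "C2 \<Rightarrow> C2 \<Rightarrow> real" where
  "kappa z X = Im (cnj (fst z) * fst X) - Im (cnj (snd z) * snd X)"

definition f :: "C2 \<Rightarrow> real" where
  "f z = 1 + half_df z z"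

definition twist :: "C2 \<Rightarrow> C2" where
  "twist z = (- (\<i> * of_real B * fst z), \<i> * of_real A * snd z)"

definition coframe :: "C2 \<Rightarrow> C2 \<Rightarrow> C2" where
  "coframe z X = f z *\<^sub>R X + kappa z X *\<^sub>R twist z"

definition frame :: "C2 \<Rightarrow> C2 \<Rightarrow> C2" where
  "frame z a = inverse (f z) *\<^sub>R (a - kappa z a *\<^sub>R twist z)"

definition coframe' :: "C2 \<Rightarrow> C2 \<Rightarrow> C2 \<Rightarrow> C2" where
  "coframe' z X Y = (2 * half_df z X) *\<^sub>R Y + (kappa X Y *\<^sub>R twist z + kappa z Y *\<^sub>R twist X)"

definition coframe'' :: "C2 \<Rightarrow> C2 \<Rightarrow> C2 \<Rightarrow> C2 \<Rightarrow> C2" where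
  "coframe'' z X Y Z = (2 * half_df X Y) *\<^sub>R Z + (kappa Y Z *\<^sub>R twist X + kappa X Z *\<^sub>R twist Y)"

text \<open>The connection matrix is \<open>n / f\<^sup>2\<close> with the following entries. They arise from Cartan's structure
  equations for the coframe \<open>coframe / sqrt f\<close>, unitary up to a constant factor, in polar coordinates; undoing
  the rotation by the arguments of \<open>z1\<close> and \<open>z2\<close> and the normalization removes all singularities
  along the axes.\<close>

definition n11 :: "C2 \<Rightarrow> C2 \<Rightarrow> complex" where
  "n11 z X = - (of_real B * cnj (fst z) * fst (coframe z X)) - of_real A * snd z * cnj (snd (coframe z X)) - \<i> * of_real B * of_real (f z * kappa z X)"
definition n12 :: "C2 \<Rightarrow> C2 \<Rightarrow> complex" where
  "n12 z X = of_real A * cnj (snd z) * fst (coframe z X) - of_real B * fst z * cnj (snd (coframe z X))"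
definition n21 :: "C2 \<Rightarrow> C2 \<Rightarrow> complex" where
  "n21 z X = of_real B * cnj (fst z) * snd (coframe z X) - of_real A * snd z * cnj (fst (coframe z X))"
definition n22 :: "C2 \<Rightarrow> C2 \<Rightarrow> complex" where
  "n22 z X = - (of_real A * cnj (snd z) * snd (coframe z X)) - of_real B * fst z * cnj (fst (coframe z X)) + \<i> * of_real A * of_real (f z * kappa z X)"

definition conn :: "C2 \<Rightarrow> C2 \<Rightarrow> C2 \<Rightarrow> C2" where
  "conn z X a = inverse ((f z)\<^sup>2) *\<^sub>R (n11 z X * fst a + n12 z X * snd a, n21 z X * fst a + n22 z X * snd a)"

text \<open>The derivatives of these entries at a constant vector \<open>Y\<close> in the direction \<open>X\<close>.\<close>

definition n11' :: "C2 \<Rightarrow> C2 \<Rightarrow> C2 \<Rightarrow> complex" where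
  "n11' z X Y = - (of_real B * (cnj (fst X) * fst (coframe z Y) + cnj (fst z) * fst (coframe' z X Y)))
     - of_real A * (snd X * cnj (snd (coframe z Y)) + snd z * cnj (snd (coframe' z X Y)))
     - \<i> * of_real B * of_real (2 * half_df z X * kappa z Y + f z * kappa X Y)"
definition n12' :: "C2 \<Rightarrow> C2 \<Rightarrow> C2 \<Rightarrow> complex" where
  "n12' z X Y = of_real A * (cnj (snd X) * fst (coframe z Y) + cnj (snd z) * fst (coframe' z X Y))
     - of_real B * (fst X * cnj (snd (coframe z Y)) + fst z * cnj (snd (coframe' z X Y)))"
definition n21' :: "C2 \<Rightarrow> C2 \<Rightarrow> C2 \<Rightarrow> complex" where
  "n21' z X Y = of_real B * (cnj (fst X) * snd (coframe z Y) + cnj (fst z) * snd (coframe' z X Y))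
     - of_real A * (snd X * cnj (fst (coframe z Y)) + snd z * cnj (fst (coframe' z X Y)))"
definition n22' :: "C2 \<Rightarrow> C2 \<Rightarrow> C2 \<Rightarrow> complex" where
  "n22' z X Y = - (of_real A * (cnj (snd X) * snd (coframe z Y) + cnj (snd z) * snd (coframe' z X Y)))
     - of_real B * (fst X * cnj (fst (coframe z Y)) + fst z * cnj (fst (coframe' z X Y)))
     + \<i> * of_real A * of_real (2 * half_df z X * kappa z Y + f z * kappa X Y)"

definition conn' :: "C2 \<Rightarrow> C2 \<Rightarrow> C2 \<Rightarrow> C2 \<Rightarrow> C2" where
  "conn' z X Y a = inverse ((f z)\<^sup>2) *\<^sub>R
       (n11' z X Y * fst a + n12' z X Y * snd a, n21' z X Y * fst a + n22' z X Y * snd a)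
     - (4 * half_df z X * inverse (f z ^ 3)) *\<^sub>R
       (n11 z Y * fst a + n12 z Y * snd a, n21 z Y * fst a + n22 z Y * snd a)"

definition s :: "C2 \<Rightarrow> real" where "s z = c / f z"
definition s' :: "C2 \<Rightarrow> C2 \<Rightarrow> real" where "s' z X = - (2 * c * half_df z X / (f z)\<^sup>2)"

definition metric :: "C2 \<Rightarrow> C2 \<Rightarrow> C2 \<Rightarrow> real" where
  "metric z X Y = s z * (coframe z X \<bullet> coframe z Y)"

definition times_i :: "C2 \<Rightarrow> C2" where "times_i a = (\<i> * fst a, \<i> * snd a)"

definition complex_structure :: "C2 \<Rightarrow> C2 \<Rightarrow> C2" where
  "complex_structure z X = frame z (times_i (coframe z X))"

lemma f_pos: "f z > 0"
proof -
  have "f z = 1 + A * (cmod (snd z))\<^sup>2 + B * (cmod (fst z))\<^sup>2"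
    by (simp add: f_def half_df_def cmod_def power2_eq_square)
  moreover have "A * (cmod (snd z))\<^sup>2 \<ge> 0" "B * (cmod (fst z))\<^sup>2 \<ge> 0"
    using A_pos B_pos by auto
  ultimately show ?thesis by linarith
qed

lemma f_nz [simp]: "f z \<noteq> 0"
  using f_pos[of z] by simp

lemma bilinear_half_df: "bilinear half_df" and bilinear_kappa: "bilinear kappa"
  by (auto simp: bilinear_def half_df_def kappa_def algebra_simps intro!: linearI)

lemmas bounded_bilinear_half_df = bilinear_conv_bounded_bilinear[THEN iffD1, OF bilinear_half_df]
lemmas bounded_bilinear_kappa = bilinear_conv_bounded_bilinear[THEN iffD1, OF bilinear_kappa]

lemma linear_twist: "linear twist"
  by (auto simp: twist_def algebra_simps scaleR_conv_of_real intro!: linearI)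

lemmas bounded_linear_twist = linear_conv_bounded_linear[THEN iffD1, OF linear_twist]

lemma half_df_commute: "half_df z X = half_df X z"
  by (simp add: half_df_def algebra_simps)

lemma kappa_twist: "kappa z (twist z) = 1 - f z"
  by (simp add: kappa_def twist_def f_def half_df_def algebra_simps)

lemma half_df_twist: "half_df z (twist z) = 0"
  by (simp add: half_df_def twist_def algebra_simps)

lemma kappa_linear: "linear (kappa z)" and half_df_linear: "linear (half_df z)"
  using bilinear_kappa bilinear_half_df unfolding bilinear_def by blast+

lemmas kappa_simps = linear_add[OF kappa_linear] linear_diff[OF kappa_linear] linear_cmul[OF kappa_linear]
lemmas half_df_simps = linear_add[OF half_df_linear] linear_diff[OF half_df_linear] linear_cmul[OF half_df_linear]

lemma linear_coframe: "linear (coframe z)"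
  by (rule linearI) (simp_all add: coframe_def kappa_simps algebra_simps)

text \<open>The form \<open>kappa\<close> is unchanged by the coframe because \<open>kappa\<close> of the twist is
  \<open>1 - f\<close>; this is why the coframe is inverted by \<open>frame\<close>.\<close>

lemma kappa_coframe: "kappa z (coframe z X) = kappa z X"
  by (simp add: coframe_def kappa_simps kappa_twist algebra_simps)

lemma kappa_frame: "kappa z (frame z a) = kappa z a"
  by (simp add: frame_def kappa_simps kappa_twist field_simps)

lemma half_df_frame: "half_df z (frame z a) = half_df z a / f z"
  by (simp add: frame_def half_df_simps half_df_twist field_simps)

lemma coframe_frame: "coframe z (frame z a) = a"
  by (simp add: coframe_def[of z "frame z a"] kappa_frame) (simp add: frame_def)

lemma frame_coframe: "frame z (coframe z X) = X"
  by (simp add: frame_def kappa_coframe) (simp add: coframe_def)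

lemma half_df_deriv: "((\<lambda>q. half_df q Y) has_derivative (\<lambda>X. half_df X Y)) (at p)"
  and kappa_deriv: "((\<lambda>q. kappa q Y) has_derivative (\<lambda>X. kappa X Y)) (at p)"
  by (auto intro!: bounded_linear_imp_has_derivative bounded_bilinear.bounded_linear_left
      bounded_bilinear_half_df bounded_bilinear_kappa)

lemma f_deriv: "(f has_derivative (\<lambda>X. 2 * half_df p X)) (at p)"
proof -
  have "((\<lambda>z. 1 + half_df z z) has_derivative (\<lambda>X. 0 + (half_df p X + half_df X p))) (at p)"
    by (intro has_derivative_add has_derivative_const bounded_bilinear.FDERIV[OF bounded_bilinear_half_df]
        has_derivative_ident)
  then show ?thesis by (simp add: f_def[abs_def] half_df_commute[of _ p])
qed

lemma twist_deriv: "(twist has_derivative twist) (at p)"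
  by (rule bounded_linear_imp_has_derivative[OF bounded_linear_twist])

lemma coframe_deriv: "((\<lambda>q. coframe q Y) has_derivative (\<lambda>X. coframe' p X Y)) (at p)"
  unfolding coframe_def coframe'_def
  by (auto intro!: derivative_eq_intros f_deriv kappa_deriv twist_deriv)

lemma coframe'_deriv: "((\<lambda>q. coframe' q Y Z) has_derivative (\<lambda>X. coframe'' p X Y Z)) (at p)"
  unfolding coframe'_def coframe''_def
  by (auto intro!: derivative_eq_intros half_df_deriv kappa_deriv twist_deriv)

lemma coframe''_sym: "coframe'' p X Y Z = coframe'' p Y X Z"
  by (simp add: coframe''_def half_df_commute[of X Y] algebra_simps)

lemma frame_diff: "(\<lambda>q. frame q w) differentiable (at p)"
proof -
  have "((\<lambda>q. frame q w) has_derivative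
      (\<lambda>X. inverse (f p) *\<^sub>R (0 - (kappa p w *\<^sub>R twist X + kappa X w *\<^sub>R twist p)) +
        (- (inverse (f p) * (2 * half_df p X) * inverse (f p))) *\<^sub>R (w - kappa p w *\<^sub>R twist p))) (at p)"
    unfolding frame_def
    by (intro has_derivative_scaleR has_derivative_diff has_derivative_const Deriv.has_derivative_inverse
        f_deriv kappa_deriv twist_deriv f_nz)
  then show ?thesis by (rule differentiableI)
qed

lemma s_deriv: "(s has_derivative s' p) (at p)"
proof -
  have "((\<lambda>z. c * inverse (f z)) has_derivative
      (\<lambda>X. c * (- (inverse (f p) * (2 * half_df p X) * inverse (f p))))) (at p)"
    by (intro has_derivative_mult_right Deriv.has_derivative_inverse f_deriv f_nz)
  then show ?thesis
    by (simp add: s_def[abs_def] s'_def[abs_def] field_simps power2_eq_square)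
qed

lemma cnj_deriv: "(h has_derivative h') F \<Longrightarrow> ((\<lambda>q. cnj (h q)) has_derivative (\<lambda>X. cnj (h' X))) F"
  by (rule bounded_linear.has_derivative[OF bounded_linear_cnj])

lemma n_deriv:
  "((\<lambda>q. n11 q Y) has_derivative (\<lambda>X. n11' p X Y)) (at p)"
  "((\<lambda>q. n12 q Y) has_derivative (\<lambda>X. n12' p X Y)) (at p)"
  "((\<lambda>q. n21 q Y) has_derivative (\<lambda>X. n21' p X Y)) (at p)"
  "((\<lambda>q. n22 q Y) has_derivative (\<lambda>X. n22' p X Y)) (at p)"
  unfolding n11_def n12_def n21_def n22_def n11'_def n12'_def n21'_def n22'_def
  by (auto intro!: derivative_eq_intros has_derivative_of_real f_deriv kappa_deriv coframe_deriv cnj_deriv simp: algebra_simps)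

lemma conn_deriv: "((\<lambda>q. conn q Y a) has_derivative (\<lambda>X. conn' p X Y a)) (at p)"
proof -
  let ?N = "\<lambda>q. (n11 q Y * fst a + n12 q Y * snd a, n21 q Y * fst a + n22 q Y * snd a)"
  let ?N' = "\<lambda>X. (n11' p X Y * fst a + n12' p X Y * snd a, n21' p X Y * fst a + n22' p X Y * snd a)"
  have N: "(?N has_derivative ?N') (at p)"
    by (intro has_derivative_Pair has_derivative_add has_derivative_mult_left n_deriv)
  have "((\<lambda>q. inverse ((f q)\<^sup>2)) has_derivative (\<lambda>X. - (4 * half_df p X * inverse (f p ^ 3)))) (at p)"
    by (auto intro!: derivative_eq_intros f_deriv simp: field_simps power2_eq_square power3_eq_cube)
  from has_derivative_scaleR[OF this N] show ?thesis
    unfolding conn_def conn'_def by (simp add: scaleR_left.minus)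
qed

lemma linear_conn: "linear (conn p X)"
  by (rule linearI) (simp_all add: conn_def algebra_simps scaleR_conv_of_real)

lemma conn_times_i: "conn p X (times_i a) = times_i (conn p X a)"
  by (simp add: conn_def times_i_def algebra_simps)

lemma of_real_f: "complex_of_real (f z) = 1 + of_real A * snd z * cnj (snd z) + of_real B * fst z * cnj (fst z)"
  by (simp add: f_def half_df_def complex_eq_iff algebra_simps)

end

section \<open>The connection form and the holomorphic sectional curvature\<close>

context taub_nut begin

text \<open>This is \<open>2 * \<i> * kappa\<close>. Together with the halved parameters \<open>hA\<close> and \<open>hB\<close> it
  makes all identities below free of divisions, so that they are identities between polynomials in the coordinates and their
  conjugates.\<close>

definition kappaC :: "C2 \<Rightarrow> C2 \<Rightarrow> complex" where
  "kappaC z X = cnj (fst z) * fst X - fst z * cnj (fst X) - cnj (snd z) * snd X + snd z * cnj (snd X)"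

definition hA :: complex where "hA = of_real (A / 2)"
definition hB :: complex where "hB = of_real (B / 2)"

lemma of_real_A: "of_real A = 2 * hA" and of_real_B: "of_real B = 2 * hB"
  by (simp_all add: hA_def hB_def)

lemma cnj_hA_hB: "cnj hA = hA" "cnj hB = hB"
  by (simp_all add: hA_def hB_def)

lemma kappaC_eq: "kappaC z X = 2 * \<i> * of_real (kappa z X)"
  by (simp add: kappaC_def kappa_def complex_eq_iff)

lemma cnj_kappaC: "cnj (kappaC z X) = - kappaC z X"
  by (simp add: kappaC_eq)

lemma F_eq: "complex_of_real (f z) = 1 + 2 * hA * snd z * cnj (snd z) + 2 * hB * fst z * cnj (fst z)"
  unfolding of_real_f of_real_A of_real_B by simp

lemma of_real_half_df: "of_real (half_df z X) =
    hA * (cnj (snd z) * snd X + snd z * cnj (snd X)) + hB * (cnj (fst z) * fst X + fst z * cnj (fst X))"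
  by (simp add: hA_def hB_def half_df_def complex_eq_iff field_simps)

lemma fst_coframe: "fst (coframe z X) = of_real (f z) * fst X - hB * kappaC z X * fst z"
  and snd_coframe: "snd (coframe z X) = of_real (f z) * snd X + hA * kappaC z X * snd z"
  unfolding kappaC_eq by (simp_all add: hA_def hB_def coframe_def twist_def scaleR_conv_of_real)

lemma fst_coframe': "fst (coframe' z X Y) = 2 * of_real (half_df z X) * fst Y - hB * (kappaC X Y * fst z + kappaC z Y * fst X)"
  and snd_coframe': "snd (coframe' z X Y) = 2 * of_real (half_df z X) * snd Y + hA * (kappaC X Y * snd z + kappaC z Y * snd X)"
  unfolding kappaC_eq by (simp_all add: hA_def hB_def coframe'_def twist_def scaleR_conv_of_real algebra_simps)

lemma n_eqs:
  "n11 z X = - (2 * hB * cnj (fst z) * fst (coframe z X)) - 2 * hA * snd z * cnj (snd (coframe z X)) - hB * of_real (f z) * kappaC z X"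
  "n12 z X = 2 * hA * cnj (snd z) * fst (coframe z X) - 2 * hB * fst z * cnj (snd (coframe z X))"
  "n21 z X = 2 * hB * cnj (fst z) * snd (coframe z X) - 2 * hA * snd z * cnj (fst (coframe z X))"
  "n22 z X = - (2 * hA * cnj (snd z) * snd (coframe z X)) - 2 * hB * fst z * cnj (fst (coframe z X)) + hA * of_real (f z) * kappaC z X"
  unfolding kappaC_eq n11_def n12_def n21_def n22_def of_real_A of_real_B by (simp_all add: hA_def hB_def)

text \<open>After multiplication with \<open>f\<^sup>2\<close> each component is a polynomial identity.\<close>

lemma torsion_free: "coframe' p X Y + conn p X (coframe p Y) = coframe' p Y X + conn p Y (coframe p X)"
proof (rule prod_eqI)
  define F where "F = complex_of_real (f p)"
  have F0: "F \<noteq> 0" by (simp add: F_def)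
  have F: "F = 1 + 2 * hA * snd p * cnj (snd p) + 2 * hB * fst p * cnj (fst p)"
    unfolding F_def by (rule F_eq)
  have "F\<^sup>2 * (fst (coframe' p X Y) - fst (coframe' p Y X))
    + (n11 p X * fst (coframe p Y) + n12 p X * snd (coframe p Y)) - (n11 p Y * fst (coframe p X) + n12 p Y * snd (coframe p X)) = 0"
    unfolding n_eqs fst_coframe snd_coframe fst_coframe' complex_cnj_add complex_cnj_diff complex_cnj_mult
      cnj_kappaC cnj_hA_hB complex_cnj_numeral complex_cnj_complex_of_real
    unfolding of_real_half_df F_def[symmetric] kappaC_def F
    by algebra
  then show "fst (coframe' p X Y + conn p X (coframe p Y)) = fst (coframe' p Y X + conn p Y (coframe p X))"
    using F0 by (simp add: conn_def scaleR_conv_of_real F_def[symmetric] field_simps)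
  have "F\<^sup>2 * (snd (coframe' p X Y) - snd (coframe' p Y X))
    + (n21 p X * fst (coframe p Y) + n22 p X * snd (coframe p Y)) - (n21 p Y * fst (coframe p X) + n22 p Y * snd (coframe p X)) = 0"
    unfolding n_eqs fst_coframe snd_coframe snd_coframe' complex_cnj_add complex_cnj_diff complex_cnj_mult
      cnj_kappaC cnj_hA_hB complex_cnj_numeral complex_cnj_complex_of_real
    unfolding of_real_half_df F_def[symmetric] kappaC_def F
    by algebra
  then show "snd (coframe' p X Y + conn p X (coframe p Y)) = snd (coframe' p Y X + conn p Y (coframe p X))"
    using F0 by (simp add: conn_def scaleR_conv_of_real F_def[symmetric] field_simps)
qed

text \<open>The Hermitian part of the connection matrix is scalar: this is what compatibility with a conformally Euclidean metric
  requires.\<close>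

lemma hermitian_n:
  shows "n11 z X + cnj (n11 z X) = - of_real (2 * f z * half_df z X)"
    and "n22 z X + cnj (n22 z X) = - of_real (2 * f z * half_df z X)"
    and "n12 z X + cnj (n21 z X) = 0"
proof -
  define F where "F = complex_of_real (f z)"
  show "n11 z X + cnj (n11 z X) = - of_real (2 * f z * half_df z X)"
    unfolding n_eqs fst_coframe snd_coframe complex_cnj_add complex_cnj_diff complex_cnj_mult complex_cnj_minus
      complex_cnj_cnj cnj_kappaC cnj_hA_hB complex_cnj_numeral complex_cnj_complex_of_real of_real_mult
    unfolding of_real_half_df F_def[symmetric] kappaC_def of_real_numeral
    by algebra
  show "n22 z X + cnj (n22 z X) = - of_real (2 * f z * half_df z X)"
    unfolding n_eqs fst_coframe snd_coframe complex_cnj_add complex_cnj_diff complex_cnj_mult complex_cnj_minus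
      complex_cnj_cnj cnj_kappaC cnj_hA_hB complex_cnj_numeral complex_cnj_complex_of_real of_real_mult
    unfolding of_real_half_df F_def[symmetric] kappaC_def of_real_numeral
    by algebra
  show "n12 z X + cnj (n21 z X) = 0"
    by (simp add: n12_def n21_def)
qed

lemma inner_C2: "2 * complex_of_real (v \<bullet> w) =
    fst v * cnj (fst w) + cnj (fst v) * fst w + snd v * cnj (snd w) + cnj (snd v) * snd w"
  by (simp add: inner_prod_def inner_complex_def complex_eq_iff)

lemma conn_compatible: "s p * (conn p X v \<bullet> w + v \<bullet> conn p X w) = s' p X * (v \<bullet> w)"
proof -
  define F where "F = complex_of_real (f p)"
  have F0: "F \<noteq> 0" by (simp add: F_def)
  define N where "N = (\<lambda>v. (n11 p X * fst v + n12 p X * snd v, n21 p X * fst v + n22 p X * snd v))"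
  have n21: "n21 p X = - cnj (n12 p X)"
    using hermitian_n(3)[of p X] by (metis add_eq_0_iff complex_cnj_cnj complex_cnj_minus)
  define H where "H = complex_of_real (2 * f p * half_df p X)"
  have n11: "cnj (n11 p X) = - H - n11 p X" and n22: "cnj (n22 p X) = - H - n22 p X"
    using hermitian_n(1,2)[of p X] unfolding H_def by (metis add_diff_cancel_left')+
  have "2 * of_real (N v \<bullet> w) + 2 * of_real (v \<bullet> N w) = - H * (2 * of_real (v \<bullet> w))"
    unfolding inner_C2 N_def fst_conv snd_conv complex_cnj_add complex_cnj_mult
      n21 n11 n22 complex_cnj_minus complex_cnj_cnj
    by algebra
  then have "complex_of_real (N v \<bullet> w + v \<bullet> N w) = of_real (- (2 * f p * half_df p X) * (v \<bullet> w))"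
    unfolding H_def by (simp add: distrib_left[symmetric] mult.left_commute[of _ 2] del: distrib_left_numeral)
  then have "N v \<bullet> w + v \<bullet> N w = - (2 * f p * half_df p X) * (v \<bullet> w)"
    by (simp only: of_real_eq_iff)
  moreover have "conn p X v = inverse ((f p)\<^sup>2) *\<^sub>R N v" for v
    by (simp add: conn_def N_def)
  then have "conn p X v \<bullet> w + v \<bullet> conn p X w = inverse ((f p)\<^sup>2) * (N v \<bullet> w + v \<bullet> N w)"
    by (simp add: distrib_left)
  ultimately have e: "conn p X v \<bullet> w + v \<bullet> conn p X w = inverse ((f p)\<^sup>2) * (- (2 * f p * half_df p X) * (v \<bullet> w))"
    by simp
  show ?thesis
    unfolding e s_def s'_def by (simp add: field_simps power2_eq_square)
qed

sublocale conformal_coframe2 metric s s' coframe coframe' frame conn coframe'' conn'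
proof (intro conformal_coframe2.intro conformal_coframe.intro conformal_coframe2_axioms.intro)
  show "s p > 0" for p using c_pos f_pos[of p] by (simp add: s_def)
qed (rule metric_def s_deriv linear_coframe coframe_frame frame_coframe coframe_deriv frame_diff torsion_free
    conn_compatible linear_conn conn_deriv coframe'_deriv coframe''_sym)+

lemma n'_eqs:
  "n11' z X Y = - (2 * hB * (cnj (fst X) * fst (coframe z Y) + cnj (fst z) * fst (coframe' z X Y)))
     - 2 * hA * (snd X * cnj (snd (coframe z Y)) + snd z * cnj (snd (coframe' z X Y)))
     - hB * (2 * of_real (half_df z X) * kappaC z Y + of_real (f z) * kappaC X Y)"
  "n12' z X Y = 2 * hA * (cnj (snd X) * fst (coframe z Y) + cnj (snd z) * fst (coframe' z X Y))
     - 2 * hB * (fst X * cnj (snd (coframe z Y)) + fst z * cnj (snd (coframe' z X Y)))"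
  "n21' z X Y = 2 * hB * (cnj (fst X) * snd (coframe z Y) + cnj (fst z) * snd (coframe' z X Y))
     - 2 * hA * (snd X * cnj (fst (coframe z Y)) + snd z * cnj (fst (coframe' z X Y)))"
  "n22' z X Y = - (2 * hA * (cnj (snd X) * snd (coframe z Y) + cnj (snd z) * snd (coframe' z X Y)))
     - 2 * hB * (fst X * cnj (fst (coframe z Y)) + fst z * cnj (fst (coframe' z X Y)))
     + hA * (2 * of_real (half_df z X) * kappaC z Y + of_real (f z) * kappaC X Y)"
  unfolding n11'_def n12'_def n21'_def n22'_def of_real_A of_real_B kappaC_eq by (simp_all add: algebra_simps)

text \<open>The entries of the curvature matrix on \<open>(X, JX)\<close>, multiplied by \<open>f ^ 4\<close>. In terms of the
  components of \<open>e = coframe p X\<close> they form \<open>\<i>\<close> times a Hermitian matrix; that the coefficient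
  \<open>4 * (hA + hB) * F - S\<close> occurs both off the diagonal and in the mixed diagonal terms is the curvature
  symmetry of a Kaehler metric. Writing \<open>X\<close> as \<open>frame p e\<close> turns each claim into a polynomial
  identity in \<open>p\<close> and \<open>e\<close>.\<close>

lemma curv_entries:
  fixes p e :: C2
  defines "X \<equiv> frame p e" and "Y \<equiv> frame p (times_i e)" and "F \<equiv> complex_of_real (f p)"
    and "S \<equiv> 16 * (hA\<^sup>2 * snd p * cnj (snd p) + hB\<^sup>2 * fst p * cnj (fst p))"
  shows "F\<^sup>2 * (n11' p X Y - n11' p Y X) - 4 * F * (of_real (half_df p X) * n11 p Y - of_real (half_df p Y) * n11 p X)
      + (n12 p X * n21 p Y - n12 p Y * n21 p X)
    = \<i> * ((S - 8 * hB * F) * fst e * cnj (fst e) + (4 * (hA + hB) * F - S) * snd e * cnj (snd e))" (is ?E11)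
  and "F\<^sup>2 * (n22' p X Y - n22' p Y X) - 4 * F * (of_real (half_df p X) * n22 p Y - of_real (half_df p Y) * n22 p X)
      + (n21 p X * n12 p Y - n21 p Y * n12 p X)
    = \<i> * ((4 * (hA + hB) * F - S) * fst e * cnj (fst e) + (S - 8 * hA * F) * snd e * cnj (snd e))" (is ?E22)
  and "F\<^sup>2 * (n12' p X Y - n12' p Y X) - 4 * F * (of_real (half_df p X) * n12 p Y - of_real (half_df p Y) * n12 p X)
      + (n11 p X * n12 p Y - n11 p Y * n12 p X + n12 p X * n22 p Y - n12 p Y * n22 p X)
    = \<i> * ((4 * (hA + hB) * F - S) * fst e * cnj (snd e))" (is ?E12)
  and "F\<^sup>2 * (n21' p X Y - n21' p Y X) - 4 * F * (of_real (half_df p X) * n21 p Y - of_real (half_df p Y) * n21 p X)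
      + (n21 p X * n11 p Y - n21 p Y * n11 p X + n22 p X * n21 p Y - n22 p Y * n21 p X)
    = \<i> * ((4 * (hA + hB) * F - S) * snd e * cnj (fst e))" (is ?E21)
proof -
  define z1 c1 z2 c2 where "z1 = fst p" and "c1 = cnj z1" and "z2 = snd p" and "c2 = cnj z2"
  define e1 d1 e2 d2 where "e1 = fst e" and "d1 = cnj e1" and "e2 = snd e" and "d2 = cnj e2"
  note atoms = z1_def[symmetric] c1_def[symmetric] z2_def[symmetric] c2_def[symmetric]
    e1_def[symmetric] d1_def[symmetric] e2_def[symmetric] d2_def[symmetric]
  have cc: "cnj c1 = z1" "cnj c2 = z2" "cnj d1 = e1" "cnj d2 = e2" "cnj z1 = c1" "cnj z2 = c2"
      "cnj e1 = d1" "cnj e2 = d2" "cnj F = F"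
    by (simp_all add: c1_def c2_def d1_def d2_def F_def)
  have F: "F = 1 + 2 * hA * z2 * c2 + 2 * hB * z1 * c1"
    unfolding F_def F_eq atoms ..
  have F0: "F \<noteq> 0" by (simp add: F_def)
  define K L where "K = c1 * e1 - z1 * d1 - c2 * e2 + z2 * d2" and "L = c1 * e1 + z1 * d1 - c2 * e2 - z2 * d2"
  \<comment> \<open>Every quantity belonging to \<open>Y = JX\<close> is \<open>\<i>\<close> times an expression of the same kind as for \<open>X\<close>; splitting off
      this factor leaves identities that hold in any commutative ring.\<close>
  have coframe: "fst (coframe p X) = e1" "snd (coframe p X) = e2" "fst (coframe p Y) = \<i> * e1" "snd (coframe p Y) = \<i> * e2"
    by (simp_all add: X_def Y_def coframe_frame times_i_def e1_def e2_def)
  have kappaC_X: "kappaC p X = K"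
    unfolding X_def kappaC_eq kappa_frame unfolding kappaC_eq[symmetric] kappaC_def K_def atoms ..
  have "kappaC p (times_i e) = \<i> * L"
    by (simp add: kappaC_def times_i_def L_def z1_def z2_def e1_def e2_def c1_def c2_def d1_def d2_def algebra_simps)
  then have kappaC_Y: "kappaC p Y = \<i> * L"
    unfolding Y_def kappaC_eq kappa_frame .
  have X: "F * fst X = e1 + hB * K * z1" "F * snd X = e2 - hA * K * z2"
    "F * fst Y = \<i> * (e1 + hB * L * z1)" "F * snd Y = \<i> * (e2 - hA * L * z2)"
    using fst_coframe[of p X] snd_coframe[of p X] fst_coframe[of p Y] snd_coframe[of p Y]
    unfolding coframe kappaC_X kappaC_Y F_def[symmetric] atoms by (simp_all add: algebra_simps)
  have cX: "F * cnj (fst X) = d1 - hB * K * c1" "F * cnj (snd X) = d2 + hA * K * c2"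
    "F * cnj (fst Y) = - \<i> * (d1 + hB * L * c1)" "F * cnj (snd Y) = - \<i> * (d2 - hA * L * c2)"
    using X[THEN arg_cong[of _ _ cnj]]
    by (simp_all add: cc cnj_hA_hB K_def L_def algebra_simps)
  define DX DY where "DX = hA * (c2 * e2 + z2 * d2) + hB * (c1 * e1 + z1 * d1)"
    and "DY = hA * (c2 * e2 - z2 * d2) + hB * (c1 * e1 - z1 * d1)"
  have hX: "F * of_real (half_df p X) = DX"
    using F0 unfolding X_def half_df_frame by (simp add: F_def of_real_half_df DX_def atoms)
  have hY: "F * of_real (half_df p Y) = \<i> * DY"
    using F0 unfolding Y_def half_df_frame by (simp add: F_def of_real_half_df DY_def times_i_def atoms field_simps)
  have kappaC_XY: "F\<^sup>2 * kappaC X Y = \<i> * ((d1 - hB * K * c1) * (e1 + hB * L * z1) + (e1 + hB * K * z1) * (d1 + hB * L * c1)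
      - (d2 + hA * K * c2) * (e2 - hA * L * z2) - (e2 - hA * K * z2) * (d2 - hA * L * c2))"
  proof -
    have "F\<^sup>2 * kappaC X Y = (F * cnj (fst X)) * (F * fst Y) - (F * fst X) * (F * cnj (fst Y))
      - (F * cnj (snd X)) * (F * snd Y) + (F * snd X) * (F * cnj (snd Y))"
      unfolding kappaC_def by (simp add: algebra_simps power2_eq_square)
    then show ?thesis unfolding X cX by (simp add: algebra_simps)
  qed
  have kappaC_YX: "kappaC Y X = - kappaC X Y"
    by (simp add: kappaC_def algebra_simps)
  define N11X N11Y where "N11X = - 2 * hB * c1 * e1 - 2 * hA * z2 * d2 - hB * F * K"
    and "N11Y = - 2 * hB * c1 * e1 + 2 * hA * z2 * d2 - hB * F * L"
  define N12X N12Y where "N12X = 2 * hA * c2 * e1 - 2 * hB * z1 * d2" and "N12Y = 2 * hA * c2 * e1 + 2 * hB * z1 * d2"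
  define N21X N21Y where "N21X = 2 * hB * c1 * e2 - 2 * hA * z2 * d1" and "N21Y = 2 * hB * c1 * e2 + 2 * hA * z2 * d1"
  define N22X N22Y where "N22X = - 2 * hA * c2 * e2 - 2 * hB * z1 * d1 + hA * F * K"
    and "N22Y = - 2 * hA * c2 * e2 + 2 * hB * z1 * d1 + hA * F * L"
  note N_defs = N11X_def N11Y_def N12X_def N12Y_def N21X_def N21Y_def N22X_def N22Y_def
  have nX: "n11 p X = N11X" "n12 p X = N12X" "n21 p X = N21X" "n22 p X = N22X"
    and nY: "n11 p Y = \<i> * N11Y" "n12 p Y = \<i> * N12Y" "n21 p Y = \<i> * N21Y" "n22 p Y = \<i> * N22Y"
    unfolding n_eqs coframe kappaC_X kappaC_Y N_defs F_def[symmetric] by (simp_all add: atoms cc algebra_simps)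
  define t1 t2 where "t1 = N11Y * e1 + N12Y * e2 - N11X * e1 - N12X * e2"
    and "t2 = N21Y * e1 + N22Y * e2 - N21X * e1 - N22X * e2"
  have T: "F\<^sup>2 * (fst (coframe' p X Y) - fst (coframe' p Y X)) = \<i> * t1"
    "F\<^sup>2 * (snd (coframe' p X Y) - snd (coframe' p Y X)) = \<i> * t2"
  proof -
    have "coframe' p X Y - coframe' p Y X = conn p Y (coframe p X) - conn p X (coframe p Y)"
      using torsion_free[of p X Y] by (simp add: algebra_simps)
    from arg_cong[OF this, of fst] arg_cong[OF this, of snd]
    have "fst (coframe' p X Y) - fst (coframe' p Y X) = \<i> * t1 / F\<^sup>2"
      "snd (coframe' p X Y) - snd (coframe' p Y X) = \<i> * t2 / F\<^sup>2"
      by (simp_all add: conn_def nX nY coframe t1_def t2_def scaleR_conv_of_real F_def[symmetric] divide_inverse algebra_simps)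
    then show "F\<^sup>2 * (fst (coframe' p X Y) - fst (coframe' p Y X)) = \<i> * t1"
      "F\<^sup>2 * (snd (coframe' p X Y) - snd (coframe' p Y X)) = \<i> * t2"
      using F0 by simp_all
  qed
  define u1 u2 where "u1 = cnj t1" and "u2 = cnj t2"
  have cT: "F\<^sup>2 * (cnj (fst (coframe' p X Y)) - cnj (fst (coframe' p Y X))) = - \<i> * u1"
    "F\<^sup>2 * (cnj (snd (coframe' p X Y)) - cnj (snd (coframe' p Y X))) = - \<i> * u2"
    using T[THEN arg_cong[of _ _ cnj]] by (simp_all add: cc u1_def u2_def)
  have t: "t1 = (4 * hA * z2 * d2 - 2 * hB * F * (z1 * d1 - z2 * d2)) * e1 + 4 * hB * z1 * d2 * e2"
    "t2 = 4 * hA * z2 * d1 * e1 + (4 * hB * z1 * d1 + 2 * hA * F * (z1 * d1 - z2 * d2)) * e2"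
    unfolding t1_def t2_def N_defs K_def L_def by algebra+
  have u: "u1 = (4 * hA * c2 * e2 - 2 * hB * F * (c1 * e1 - c2 * e2)) * d1 + 4 * hB * c1 * e2 * d2"
    "u2 = 4 * hA * c2 * e1 * d1 + (4 * hB * c1 * e1 + 2 * hA * F * (c1 * e1 - c2 * e2)) * d2"
    unfolding u1_def u2_def t by (simp_all add: cc cnj_hA_hB)
  note defs = X cX hX hY kappaC_XY T cT kappaC_X kappaC_Y
  have D11: "F\<^sup>2 * (n11' p X Y - n11' p Y X) =
      - 2 * hB * (F * ((F * cnj (fst X)) * (\<i> * e1) - (F * cnj (fst Y)) * e1)
          + c1 * (F\<^sup>2 * (fst (coframe' p X Y) - fst (coframe' p Y X))))
      - 2 * hA * (F * (- (F * snd X) * (\<i> * d2) - (F * snd Y) * d2)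
          + z2 * (F\<^sup>2 * (cnj (snd (coframe' p X Y)) - cnj (snd (coframe' p Y X)))))
      - hB * (2 * F * ((F * of_real (half_df p X)) * kappaC p Y - (F * of_real (half_df p Y)) * kappaC p X) + 2 * F * (F\<^sup>2 * kappaC X Y))"
    unfolding n'_eqs coframe kappaC_YX complex_cnj_mult complex_cnj_i atoms F_def[symmetric] by algebra
  show ?E11
  proof -
    have "F\<^sup>2 * (n11' p X Y - n11' p Y X) - 4 * ((F * of_real (half_df p X)) * n11 p Y - (F * of_real (half_df p Y)) * n11 p X)
      + (n12 p X * n21 p Y - n12 p Y * n21 p X)
    = \<i> * ((S - 8 * hB * F) * fst e * cnj (fst e) + (4 * (hA + hB) * F - S) * snd e * cnj (snd e))"
      unfolding D11 defs nX nY t u S_def atoms unfolding N_defs DX_def DY_def K_def L_def F by algebra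
    then show ?thesis by (simp add: algebra_simps)
  qed
  have D22: "F\<^sup>2 * (n22' p X Y - n22' p Y X) =
      - 2 * hA * (F * ((F * cnj (snd X)) * (\<i> * e2) - (F * cnj (snd Y)) * e2)
          + c2 * (F\<^sup>2 * (snd (coframe' p X Y) - snd (coframe' p Y X))))
      - 2 * hB * (F * (- (F * fst X) * (\<i> * d1) - (F * fst Y) * d1)
          + z1 * (F\<^sup>2 * (cnj (fst (coframe' p X Y)) - cnj (fst (coframe' p Y X)))))
      + hA * (2 * F * ((F * of_real (half_df p X)) * kappaC p Y - (F * of_real (half_df p Y)) * kappaC p X) + 2 * F * (F\<^sup>2 * kappaC X Y))"
    unfolding n'_eqs coframe kappaC_YX complex_cnj_mult complex_cnj_i atoms F_def[symmetric] by algebra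
  show ?E22
  proof -
    have "F\<^sup>2 * (n22' p X Y - n22' p Y X) - 4 * ((F * of_real (half_df p X)) * n22 p Y - (F * of_real (half_df p Y)) * n22 p X)
      + (n21 p X * n12 p Y - n21 p Y * n12 p X)
    = \<i> * ((4 * (hA + hB) * F - S) * fst e * cnj (fst e) + (S - 8 * hA * F) * snd e * cnj (snd e))"
      unfolding D22 defs nX nY t u S_def atoms unfolding N_defs DX_def DY_def K_def L_def F by algebra
    then show ?thesis by (simp add: algebra_simps)
  qed
  have D12: "F\<^sup>2 * (n12' p X Y - n12' p Y X) =
      2 * hA * (F * ((F * cnj (snd X)) * (\<i> * e1) - (F * cnj (snd Y)) * e1)
          + c2 * (F\<^sup>2 * (fst (coframe' p X Y) - fst (coframe' p Y X))))
      - 2 * hB * (F * (- (F * fst X) * (\<i> * d2) - (F * fst Y) * d2)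
          + z1 * (F\<^sup>2 * (cnj (snd (coframe' p X Y)) - cnj (snd (coframe' p Y X)))))"
    unfolding n'_eqs coframe complex_cnj_mult complex_cnj_i atoms F_def[symmetric] by algebra
  show ?E12
  proof -
    have "F\<^sup>2 * (n12' p X Y - n12' p Y X) - 4 * ((F * of_real (half_df p X)) * n12 p Y - (F * of_real (half_df p Y)) * n12 p X)
      + (n11 p X * n12 p Y - n11 p Y * n12 p X + n12 p X * n22 p Y - n12 p Y * n22 p X)
    = \<i> * ((4 * (hA + hB) * F - S) * fst e * cnj (snd e))"
      unfolding D12 defs nX nY t u S_def atoms unfolding N_defs DX_def DY_def K_def L_def F by algebra
    then show ?thesis by (simp add: algebra_simps)
  qed
  have D21: "F\<^sup>2 * (n21' p X Y - n21' p Y X) =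
      2 * hB * (F * ((F * cnj (fst X)) * (\<i> * e2) - (F * cnj (fst Y)) * e2)
          + c1 * (F\<^sup>2 * (snd (coframe' p X Y) - snd (coframe' p Y X))))
      - 2 * hA * (F * (- (F * snd X) * (\<i> * d1) - (F * snd Y) * d1)
          + z2 * (F\<^sup>2 * (cnj (fst (coframe' p X Y)) - cnj (fst (coframe' p Y X)))))"
    unfolding n'_eqs coframe complex_cnj_mult complex_cnj_i atoms F_def[symmetric] by algebra
  show ?E21
  proof -
    have "F\<^sup>2 * (n21' p X Y - n21' p Y X) - 4 * ((F * of_real (half_df p X)) * n21 p Y - (F * of_real (half_df p Y)) * n21 p X)
      + (n21 p X * n11 p Y - n21 p Y * n11 p X + n22 p X * n21 p Y - n22 p Y * n21 p X)
    = \<i> * ((4 * (hA + hB) * F - S) * snd e * cnj (fst e))"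
      unfolding D21 defs nX nY t u S_def atoms unfolding N_defs DX_def DY_def K_def L_def F by algebra
    then show ?thesis by (simp add: algebra_simps)
  qed
qed

lemma curv_form_entries:
  fixes p X Y v :: C2
  defines "F \<equiv> complex_of_real (f p)"
  shows "fst (curv_form p X Y v) = inverse (F ^ 4) *
      ((F\<^sup>2 * (n11' p X Y - n11' p Y X) - 4 * F * (of_real (half_df p X) * n11 p Y - of_real (half_df p Y) * n11 p X)
        + (n12 p X * n21 p Y - n12 p Y * n21 p X)) * fst v
     + (F\<^sup>2 * (n12' p X Y - n12' p Y X) - 4 * F * (of_real (half_df p X) * n12 p Y - of_real (half_df p Y) * n12 p X)
        + (n11 p X * n12 p Y - n11 p Y * n12 p X + n12 p X * n22 p Y - n12 p Y * n22 p X)) * snd v)" (is ?F)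
    and "snd (curv_form p X Y v) = inverse (F ^ 4) *
      ((F\<^sup>2 * (n21' p X Y - n21' p Y X) - 4 * F * (of_real (half_df p X) * n21 p Y - of_real (half_df p Y) * n21 p X)
        + (n21 p X * n11 p Y - n21 p Y * n11 p X + n22 p X * n21 p Y - n22 p Y * n21 p X)) * fst v
     + (F\<^sup>2 * (n22' p X Y - n22' p Y X) - 4 * F * (of_real (half_df p X) * n22 p Y - of_real (half_df p Y) * n22 p X)
        + (n21 p X * n12 p Y - n21 p Y * n12 p X)) * snd v)" (is ?S)
proof -
  have F0: "F \<noteq> 0" by (simp add: F_def)
  define h where "h = inverse (F ^ 4)"
  have h: "of_real (inverse ((f p)\<^sup>2)) = h * F\<^sup>2" "of_real (4 * r * inverse (f p ^ 3)) = 4 * of_real r * (h * F)" for r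
    using F0 by (simp_all add: h_def F_def field_simps power2_eq_square power3_eq_cube power4_eq_xxxx)
  have h': "h * F\<^sup>2 * (h * F\<^sup>2) = h"
    using F0 by (simp add: h_def field_simps power2_eq_square power4_eq_xxxx)
  have 1: "h * F\<^sup>2 * (n * (h * F\<^sup>2 * r) + m * (h * F\<^sup>2 * q)) = h * (n * r + m * q)" for n m r q
    by (subst h'[symmetric]) (simp add: algebra_simps)
  show ?F ?S
    unfolding h_def[symmetric] curv_form_def conn'_def conn_def fst_add fst_diff snd_add snd_diff fst_scaleR snd_scaleR
      fst_conv snd_conv scaleR_conv_of_real h 1 by algebra+
qed

text \<open>Since the curvature matrix on \<open>(X, JX)\<close> is built from \<open>e = coframe p X\<close>, applying it to
  \<open>\<i> e\<close> multiplies the two components of \<open>e\<close> by real numbers, and the inner product with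
  \<open>e\<close> is a quadratic form in the squared moduli.\<close>

theorem holomorphic_curvature:
  fixes p X :: C2
  defines "S \<equiv> 4 * (A\<^sup>2 * (cmod (snd p))\<^sup>2 + B\<^sup>2 * (cmod (fst p))\<^sup>2)"
    and "n \<equiv> (cmod (fst (coframe p X)))\<^sup>2" and "m \<equiv> (cmod (snd (coframe p X)))\<^sup>2"
  shows "riemann_curv metric p X (complex_structure p X) (complex_structure p X) X =
     - (s p * inverse (f p ^ 4)) *
       ((S - 4 * B * f p) * n\<^sup>2 + 4 * (2 * (A + B) * f p - S) * n * m + (S - 4 * A * f p) * m\<^sup>2)"
proof -
  define e where "e = coframe p X"
  have X: "X = frame p e" and JX: "complex_structure p X = frame p (times_i e)"
    by (simp_all add: e_def frame_coframe complex_structure_def)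
  have S: "16 * (hA\<^sup>2 * snd p * cnj (snd p) + hB\<^sup>2 * fst p * cnj (fst p)) = complex_of_real S"
    unfolding S_def of_real_mult of_real_add complex_norm_square by (simp add: hA_def hB_def power_divide algebra_simps)
  have ab: "8 * hA = complex_of_real (4 * A)" "8 * hB = complex_of_real (4 * B)" "4 * (hA + hB) = complex_of_real (2 * (A + B))"
    by (simp_all add: hA_def hB_def)
  have nm: "complex_of_real n = fst e * cnj (fst e)" "complex_of_real m = snd e * cnj (snd e)"
    unfolding n_def m_def e_def complex_norm_square by simp_all
  define P where "P = - inverse (f p ^ 4) * ((S - 4 * B * f p) * n + 2 * (2 * (A + B) * f p - S) * m)"
  define Q where "Q = - inverse (f p ^ 4) * ((S - 4 * A * f p) * m + 2 * (2 * (A + B) * f p - S) * n)"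
  have ii: "\<i> * x * (\<i> * y) = - (x * y)" for x y :: complex
  proof -
    have "\<i> * x * (\<i> * y) = (\<i> * \<i>) * (x * y)" by (simp only: mult_ac)
    then show ?thesis by simp
  qed
  have inv: "complex_of_real (inverse (f p ^ 4)) = inverse (complex_of_real (f p) ^ 4)" by simp
  have "fst (curv_form p X (complex_structure p X) (times_i e)) = of_real P * fst e"
    unfolding JX unfolding X curv_form_entries curv_entries
    unfolding S ab P_def times_i_def fst_conv snd_conv ii
      of_real_mult of_real_add of_real_diff of_real_minus inv nm of_real_numeral
    by algebra
  moreover have "snd (curv_form p X (complex_structure p X) (times_i e)) = of_real Q * snd e"
    unfolding JX unfolding X curv_form_entries curv_entries
    unfolding S ab Q_def times_i_def fst_conv snd_conv ii
      of_real_mult of_real_add of_real_diff of_real_minus inv nm of_real_numeral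
    by algebra
  ultimately have "curv_form p X (complex_structure p X) (times_i e) = (P *\<^sub>R fst e, Q *\<^sub>R snd e)"
    by (simp add: prod_eq_iff scaleR_conv_of_real)
  moreover have "(P *\<^sub>R fst e, Q *\<^sub>R snd e) \<bullet> e = P * n + Q * m"
    by (simp add: inner_prod_def n_def m_def e_def power2_norm_eq_inner)
  moreover have "coframe p (complex_structure p X) = times_i e"
    by (simp add: JX coframe_frame)
  ultimately have "riemann_curv metric p X (complex_structure p X) (complex_structure p X) X = s p * (P * n + Q * m)"
    unfolding riemann_curv_eq by (simp add: e_def)
  then show ?thesis
    by (simp add: P_def Q_def algebra_simps power2_eq_square)
qed

end

section \<open>The Kaehler structure and the distribution\<close>

context taub_nut begin

lemma smooth_f: "smooth_on UNIV f"
  unfolding f_def[abs_def]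
  by (intro smooth_on_add smooth_on_const smooth_on_bounded_bilinear[OF _ bounded_bilinear_half_df] smooth_on_ident open_UNIV)

lemma smooth_kappa: "smooth_on UNIV h \<Longrightarrow> smooth_on UNIV (\<lambda>p. kappa p (h p))"
  by (intro smooth_on_bounded_bilinear[OF _ bounded_bilinear_kappa] smooth_on_ident open_UNIV)

lemma smooth_twist: "smooth_on UNIV twist"
  by (intro smooth_on_bounded_linear[OF _ bounded_linear_twist] smooth_on_ident open_UNIV)

lemma smooth_coframe: "smooth_on UNIV (\<lambda>p. coframe p X)"
  unfolding coframe_def
  by (intro smooth_on_add smooth_on_bounded_bilinear[OF _ bounded_bilinear_scaleR] smooth_on_const
      smooth_f smooth_kappa smooth_twist open_UNIV)

lemma smooth_frame: "smooth_on UNIV h \<Longrightarrow> smooth_on UNIV (\<lambda>p. frame p (h p))"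
  unfolding frame_def diff_conv_add_uminus scaleR_minus_left[symmetric]
  by (intro smooth_on_add smooth_on_bounded_bilinear[OF _ bounded_bilinear_scaleR] smooth_on_inverse
      smooth_on_bounded_linear[OF _ bounded_linear_minus[OF bounded_linear_ident]]
      smooth_f smooth_kappa smooth_twist open_UNIV f_nz)

lemma linear_times_i: "linear times_i"
  by (rule linearI) (simp_all add: times_i_def algebra_simps)

lemmas bounded_linear_times_i = linear_conv_bounded_linear[THEN iffD1, OF linear_times_i]

lemma smooth_metric: "smooth_on UNIV (\<lambda>p. metric p X Y)"
  unfolding metric_def s_def divide_inverse
  by (intro smooth_on_mult smooth_on_bounded_bilinear[OF _ bounded_bilinear_inner] smooth_on_inverse
      smooth_on_const smooth_f smooth_coframe open_UNIV f_nz)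

lemma smooth_complex_structure: "smooth_on UNIV (\<lambda>p. complex_structure p X)"
  unfolding complex_structure_def
  by (intro smooth_frame smooth_on_bounded_linear[OF _ bounded_linear_times_i] smooth_coframe open_UNIV)

lemma coframe_complex_structure: "coframe p (complex_structure p X) = times_i (coframe p X)"
  by (simp add: complex_structure_def coframe_frame)

lemma times_i_isometry: "times_i v \<bullet> times_i w = v \<bullet> w"
  by (simp add: times_i_def inner_prod_def inner_complex_def)

theorem kaehler: "kaehler_surface UNIV metric complex_structure"
  unfolding kaehler_surface_def riemannian_metric_on_def
proof (intro conjI ballI allI impI)
  show "DIM(C2) = 4" by simp
  show "linear (complex_structure p)" for p
    unfolding complex_structure_def[abs_def]
    using linear_compose[OF linear_compose[OF linear_coframe linear_times_i] \<Theta>i_lin]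
    by (simp add: o_def)
  show "complex_structure p (complex_structure p X) = - X" for p X
  proof -
    have "times_i (times_i v) = - v" for v by (simp add: times_i_def prod_eq_iff)
    then have "complex_structure p (complex_structure p X) = frame p (- coframe p X)"
      by (simp add: complex_structure_def coframe_frame)
    then show ?thesis by (simp add: linear_neg[OF \<Theta>i_lin] frame_coframe)
  qed
  show "metric p (complex_structure p X) (complex_structure p Y) = metric p X Y" for p X Y
    by (simp add: metric_def coframe_complex_structure times_i_isometry)
  show "cov_deriv metric (\<lambda>_. X) (\<lambda>q. complex_structure q Y) p =
      complex_structure p (cov_deriv metric (\<lambda>_. X) (\<lambda>_. Y) p)" for p X Y
    by (rule parallel_endomorphism[OF complex_structure_def bounded_linear_times_i conn_times_i])
  show "metric p X Y = metric p Y X" for p X Y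
    by (simp add: metric_def inner_commute)
qed (auto intro: metric_bilinear metric_pos smooth_metric smooth_complex_structure)

text \<open>Off the axes this is the plane spanned by the gradient of \<open>|z2|\<close> and its image under the complex structure; as
  the kernel of the first component of the coframe it also makes sense on the axes.\<close>

definition distribution :: "C2 \<Rightarrow> C2 set" where
  "distribution p = {X. fst (coframe p X) = 0}"

lemma mem_distribution: "X \<in> distribution p \<longleftrightarrow> X = frame p (0, snd (coframe p X))"
  by (metis (mono_tags, lifting) coframe_frame frame_coframe distribution_def fst_conv mem_Collect_eq prod.collapse)

lemma plane_distribution: "plane_distribution_on UNIV distribution"
  unfolding plane_distribution_on_def
proof (intro conjI ballI)
  fix p :: C2
  show "subspace (distribution p)"
    by (auto simp: distribution_def subspace_def linear_add[OF linear_coframe] linear_cmul[OF linear_coframe] linear_0[OF linear_coframe])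
  define L where "L = (\<lambda>w::complex. frame p (0, w))"
  have L: "linear L"
    unfolding L_def using linear_compose[OF bounded_linear.linear[OF bounded_linear_Pair[OF bounded_linear_zero bounded_linear_ident]] \<Theta>i_lin]
    by (simp add: o_def)
  have inj: "inj L"
    unfolding L_def by (rule injI) (metis coframe_frame snd_conv)
  have "distribution p = range L"
    using mem_distribution[of _ p] by (auto simp: L_def coframe_frame distribution_def)
  then show "dim (distribution p) = 2"
    using dim_image_eq[OF L, of UNIV] inj by simp
  have "distribution q = span {frame q (0, 1), frame q (0, \<i>)}" for q
  proof (intro subset_antisym subsetI)
    fix X assume "X \<in> distribution q"
    moreover have "(0, snd (coframe q X)) = Re (snd (coframe q X)) *\<^sub>R (0, 1) + Im (snd (coframe q X)) *\<^sub>R (0::complex, \<i>)"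
      by (simp add: complex_eq_iff)
    ultimately have "X = frame q (Re (snd (coframe q X)) *\<^sub>R (0, 1) + Im (snd (coframe q X)) *\<^sub>R (0, \<i>))"
      using mem_distribution by metis
    also have "\<dots> = Re (snd (coframe q X)) *\<^sub>R frame q (0, 1) + Im (snd (coframe q X)) *\<^sub>R frame q (0, \<i>)"
      by (simp only: linear_add[OF \<Theta>i_lin] linear_cmul[OF \<Theta>i_lin])
    also have "\<dots> \<in> span {frame q (0, 1), frame q (0, \<i>)}"
      by (intro span_add span_scale span_base) auto
    finally show "X \<in> span {frame q (0, 1), frame q (0, \<i>)}" .
  next
    fix X assume "X \<in> span {frame q (0, 1), frame q (0, \<i>)}"
    moreover have "subspace (distribution q)"
      by (auto simp: distribution_def subspace_def linear_add[OF linear_coframe] linear_cmul[OF linear_coframe] linear_0[OF linear_coframe])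
    moreover have "{frame q (0, 1), frame q (0, \<i>)} \<subseteq> distribution q"
      by (simp add: distribution_def coframe_frame)
    ultimately show "X \<in> distribution q"
      using span_minimal by blast
  qed
  then show "\<exists>V A B. open V \<and> p \<in> V \<and> V \<subseteq> UNIV \<and> smooth_on V A \<and> smooth_on V B \<and>
      (\<forall>q\<in>V. distribution q = span {A q, B q})"
    by (intro exI[of _ UNIV] exI[of _ "\<lambda>q. frame q (0, 1)"] exI[of _ "\<lambda>q. frame q (0, \<i>)"])
      (auto intro: smooth_frame smooth_on_const)
qed

lemma orth_proj_distribution: "orth_proj metric distribution p X = frame p (0, snd (coframe p X))"
  unfolding orth_proj_def
proof (rule the_equality)
  let ?P = "frame p (0, snd (coframe p X))"
  show "?P \<in> distribution p \<and> (\<forall>W\<in>distribution p. metric p (X - ?P) W = 0)"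
    by (auto simp: distribution_def coframe_frame metric_def linear_diff[OF linear_coframe] inner_prod_def)
  fix W assume W: "W \<in> distribution p \<and> (\<forall>Z\<in>distribution p. metric p (X - W) Z = 0)"
  have "frame p (0, snd (coframe p X) - snd (coframe p W)) \<in> distribution p"
    by (simp add: distribution_def coframe_frame)
  then have "metric p (X - W) (frame p (0, snd (coframe p X) - snd (coframe p W))) = 0"
    using W by blast
  then have "snd (coframe p X) = snd (coframe p W)"
    using s_pos[of p] by (simp add: metric_def coframe_frame linear_diff[OF linear_coframe] inner_prod_def)
  then show "W = ?P" using W by (metis mem_distribution)
qed

text \<open>For a unit vector the squared moduli \<open>n\<close> and \<open>m\<close> of the coframe components satisfy
  \<open>n + m = 1 / s\<close>, and \<open>s * m\<close> is the squared length of the projection to the distribution.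
  Hence the holomorphic curvature is determined by the point and that length.\<close>

theorem QCH: "QCH_kaehler_surface UNIV metric complex_structure"
  unfolding QCH_kaehler_surface_def
proof (intro conjI exI[of _ distribution])
  define K where "K = (\<lambda>p r. let S = 4 * (A\<^sup>2 * (cmod (snd p))\<^sup>2 + B\<^sup>2 * (cmod (fst p))\<^sup>2);
      m = r\<^sup>2 / s p; n = 1 / s p - m in - (s p * inverse (f p ^ 4)) *
       ((S - 4 * B * f p) * n\<^sup>2 + 4 * (2 * (A + B) * f p - S) * n * m + (S - 4 * A * f p) * m\<^sup>2))"
  show "\<exists>K. \<forall>p\<in>UNIV. \<forall>X. metric p X X = 1 \<longrightarrow>
      riemann_curv metric p X (complex_structure p X) (complex_structure p X) X =
      K p (sqrt (metric p (orth_proj metric distribution p X) (orth_proj metric distribution p X)))"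
  proof (intro exI[of _ K] ballI allI impI)
    fix p X assume unit: "metric p X X = 1"
    define n m where "n = (cmod (fst (coframe p X)))\<^sup>2" and "m = (cmod (snd (coframe p X)))\<^sup>2"
    have sp: "s p > 0" by (rule s_pos)
    have "metric p (orth_proj metric distribution p X) (orth_proj metric distribution p X) = s p * m"
      by (simp add: orth_proj_distribution metric_def coframe_frame inner_prod_def m_def power2_norm_eq_inner)
    then have "(sqrt (metric p (orth_proj metric distribution p X) (orth_proj metric distribution p X)))\<^sup>2 / s p = m"
      using sp by (simp add: m_def)
    moreover have "1 / s p - m = n"
      using unit sp by (simp add: metric_def inner_prod_def n_def m_def power2_norm_eq_inner field_simps)
    ultimately show "riemann_curv metric p X (complex_structure p X) (complex_structure p X) X =
      K p (sqrt (metric p (orth_proj metric distribution p X) (orth_proj metric distribution p X)))"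
      unfolding holomorphic_curvature K_def Let_def by (simp only: n_def m_def)
  qed
  show "\<forall>p\<in>UNIV. complex_structure p ` distribution p \<subseteq> distribution p"
    by (auto simp: distribution_def coframe_complex_structure times_i_def)
qed (rule kaehler plane_distribution)+

end

section \<open>Orthotoric coordinates\<close>

text \<open>The number of modulus \<open>r\<close> whose argument exceeds that of \<open>p\<close> by \<open>\<theta>\<close>.\<close>

definition from_polar :: "complex \<Rightarrow> real \<Rightarrow> real \<Rightarrow> complex" where
  "from_polar p r \<theta> = p * of_real (r / cmod p) * exp (\<i> * of_real \<theta>)"

lemma from_polar:
  assumes p: "p \<noteq> 0" and r: "r > 0" and "\<bar>\<theta>\<bar> < pi"
  shows "cmod (from_polar p r \<theta>) = r" and "Im (Ln (from_polar p r \<theta> / p)) = \<theta>"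
    and "from_polar p r \<theta> / p \<notin> \<real>\<^sub>\<le>\<^sub>0"
proof -
  show "cmod (from_polar p r \<theta>) = r"
    using p r by (simp add: from_polar_def norm_mult norm_divide)
  have e: "from_polar p r \<theta> / p = exp (Complex (ln (r / cmod p)) \<theta>)"
    unfolding exp_eq_polar[of "Complex _ _"] from_polar_def using p r by (simp add: cis_conv_exp)
  show Im: "Im (Ln (from_polar p r \<theta> / p)) = \<theta>"
    using assms(3) unfolding e by (subst Ln_exp) auto
  show "from_polar p r \<theta> / p \<notin> \<real>\<^sub>\<le>\<^sub>0"
  proof
    assume n: "from_polar p r \<theta> / p \<in> \<real>\<^sub>\<le>\<^sub>0"
    moreover have "from_polar p r \<theta> / p \<noteq> 0" by (simp add: e)
    ultimately have "Im (Ln (from_polar p r \<theta> / p)) = pi"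
      by (subst Im_Ln_eq_pi) (auto simp: complex_nonpos_Reals_iff complex_eq_iff order_le_less)
    then show False using Im assms(3) by simp
  qed
qed

lemma from_polar_Ln:
  assumes "p \<noteq> 0" "z \<noteq> 0"
  shows "from_polar p (cmod z) (Im (Ln (z / p))) = z"
proof -
  have "z / p = exp (Ln (z / p))" using assms by simp
  also have "\<dots> = of_real (exp (Re (Ln (z / p)))) * exp (\<i> * of_real (Im (Ln (z / p))))"
    unfolding exp_eq_polar[of "Ln _"] cis_conv_exp ..
  also have "exp (Re (Ln (z / p))) = cmod z / cmod p"
    using assms by (simp add: Re_Ln norm_divide)
  finally show ?thesis using assms by (simp add: from_polar_def field_simps)
qed

lemma abs_Im_Ln_less_pi: "z \<notin> \<real>\<^sub>\<le>\<^sub>0 \<Longrightarrow> \<bar>Im (Ln z)\<bar> < pi"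
  using Im_Ln_less_pi[of z] mpi_less_Im_Ln[of z] by fastforce

context taub_nut begin

text \<open>Comparing the part \<open>c f ((d|z1|)\<^sup>2 + (d|z2|)\<^sup>2)\<close> of the metric, a conformally flat metric in the
  two moduli, with the \<open>d\<xi>\<close>, \<open>d\<eta>\<close> part of an orthotoric metric with linear \<open>F\<close>
  and \<open>G\<close> makes \<open>\<xi>\<close> and \<open>\<eta>\<close> affine functions of the squared moduli, and the
  angular part then determines \<open>t\<close> and \<open>z\<close>. Arguments are measured from those of the base point
  \<open>p\<close>, so that the principal logarithm is smooth near \<open>p\<close>.\<close>

definition chart :: "C2 \<Rightarrow> C2 \<Rightarrow> R4" where
  "chart p q = (c * A * (cmod (snd q))\<^sup>2, - (c * (1 + B * (cmod (fst q))\<^sup>2)),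
     Im (Ln (fst q / fst p)) / (2 * B),
     (A * Im (Ln (fst q / fst p)) + B * Im (Ln (snd q / snd p))) / (2 * c * A * B))"

definition chart_inv :: "C2 \<Rightarrow> R4 \<Rightarrow> C2" where
  "chart_inv p w = (from_polar (fst p) (sqrt ((- (fst (snd w) / c) - 1) / B)) (2 * B * fst (snd (snd w))),
     from_polar (snd p) (sqrt (fst w / (c * A))) (2 * c * A * snd (snd (snd w)) - 2 * A * fst (snd (snd w))))"

definition chart_domain :: "C2 \<Rightarrow> C2 set" where
  "chart_domain p = {q. fst q / fst p \<notin> \<real>\<^sub>\<le>\<^sub>0 \<and> snd q / snd p \<notin> \<real>\<^sub>\<le>\<^sub>0}"

definition chart_range :: "R4 set" where
  "chart_range = {w. 0 < fst w \<and> 0 < - (fst (snd w) / c) - 1 \<and> \<bar>2 * B * fst (snd (snd w))\<bar> < pi \<and>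
     \<bar>2 * c * A * snd (snd (snd w)) - 2 * A * fst (snd (snd w))\<bar> < pi}"

lemma open_chart_domain:
  assumes "fst p \<noteq> 0" "snd p \<noteq> 0"
  shows "open (chart_domain p)"
proof -
  have "open ((\<lambda>q. fst q / fst p) -` (- \<real>\<^sub>\<le>\<^sub>0) \<inter> (\<lambda>q. snd q / snd p) -` (- \<real>\<^sub>\<le>\<^sub>0) :: C2 set)"
    using assms by (intro open_Int open_vimage open_Compl closed_nonpos_Reals_complex continuous_intros) auto
  then show ?thesis by (simp add: chart_domain_def vimage_def Int_def)
qed

lemma open_chart_range: "open chart_range"
  unfolding chart_range_def using c_pos
  by (intro open_Collect_conj open_Collect_less continuous_intros) auto

lemma smooth_chart_map:
  assumes "fst p \<noteq> 0" "snd p \<noteq> 0"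
  shows "smooth_on (chart_domain p) (chart p)"
  unfolding chart_def[abs_def] cmod_power2
  unfolding power2_eq_square divide_inverse
  by (intro smooth_on_const smooth_on_Pair smooth_on_add smooth_on_mult smooth_on_minus smooth_on_Re smooth_on_Im
      smooth_on_Ln smooth_on_fst smooth_on_snd smooth_on_ident open_chart_domain assms)
    (auto simp: chart_domain_def divide_inverse)

lemma smooth_chart_inv:
  assumes "fst p \<noteq> 0" "snd p \<noteq> 0"
  shows "smooth_on chart_range (chart_inv p)"
  unfolding chart_inv_def[abs_def] from_polar_def divide_inverse
  by (intro smooth_on_const smooth_on_Pair smooth_on_mult smooth_on_diff smooth_on_minus smooth_on_exp smooth_on_sqrt
      smooth_on_of_real smooth_on_fst smooth_on_snd smooth_on_ident open_chart_range)
    (use A_pos B_pos c_pos in \<open>auto simp: chart_range_def divide_inverse\<close>)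

lemma smooth_chart:
  assumes p: "fst p \<noteq> 0" "snd p \<noteq> 0"
  shows "smooth_chart (chart_domain p) (chart p)"
proof (rule smooth_chartI[where W = chart_range and \<rho> = "chart_inv p"])
  fix q assume q: "q \<in> chart_domain p"
  then have q0: "fst q \<noteq> 0" "snd q \<noteq> 0" by (auto simp: chart_domain_def)
  define \<theta>1 \<theta>2 where "\<theta>1 = Im (Ln (fst q / fst p))" and "\<theta>2 = Im (Ln (snd q / snd p))"
  have \<theta>: "\<bar>\<theta>1\<bar> < pi" "\<bar>\<theta>2\<bar> < pi"
    using q by (auto simp: \<theta>1_def \<theta>2_def chart_domain_def abs_Im_Ln_less_pi)
  have e: "2 * B * (\<theta>1 / (2 * B)) = \<theta>1"
    "2 * c * A * ((A * \<theta>1 + B * \<theta>2) / (2 * c * A * B)) - 2 * A * (\<theta>1 / (2 * B)) = \<theta>2"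
    "(- (- (c * (1 + B * (cmod (fst q))\<^sup>2)) / c) - 1) / B = (cmod (fst q))\<^sup>2"
    "c * A * (cmod (snd q))\<^sup>2 / (c * A) = (cmod (snd q))\<^sup>2"
    "- (- (c * (1 + B * (cmod (fst q))\<^sup>2)) / c) - 1 = B * (cmod (fst q))\<^sup>2"
    using A_pos B_pos c_pos by (simp_all add: field_simps)
  have "chart p q \<in> chart_range"
    unfolding chart_def chart_range_def \<theta>1_def[symmetric] \<theta>2_def[symmetric]
    by (simp only: mem_Collect_eq fst_conv snd_conv e \<theta>) (use A_pos B_pos c_pos q0 in simp)
  moreover have "chart_inv p (chart p q) = q"
    unfolding chart_def chart_inv_def \<theta>1_def[symmetric] \<theta>2_def[symmetric] fst_conv snd_conv e real_sqrt_abs abs_norm_cancel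
    unfolding \<theta>1_def \<theta>2_def using p q0 A_pos B_pos c_pos by (simp add: from_polar_Ln)
  ultimately show "chart p q \<in> chart_range \<and> chart_inv p (chart p q) = q" ..
next
  fix w assume w: "w \<in> chart_range"
  obtain \<xi> \<eta> t z where w_eq: "w = (\<xi>, \<eta>, t, z)" by (metis prod.collapse)
  have pos: "(- (\<eta> / c) - 1) / B > 0" "\<xi> / (c * A) > 0"
    using w A_pos B_pos c_pos by (auto simp: w_eq chart_range_def)
  define r1 r2 \<theta>1 \<theta>2 where "r1 = sqrt ((- (\<eta> / c) - 1) / B)" and "r2 = sqrt (\<xi> / (c * A))"
    and "\<theta>1 = 2 * B * t" and "\<theta>2 = 2 * c * A * z - 2 * A * t"
  have r: "r1 > 0" "r2 > 0" "r1\<^sup>2 = (- (\<eta> / c) - 1) / B" "r2\<^sup>2 = \<xi> / (c * A)"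
    using pos by (simp_all add: r1_def r2_def del: divide_pos_pos zero_less_divide_iff)
  have \<theta>: "\<bar>\<theta>1\<bar> < pi" "\<bar>\<theta>2\<bar> < pi"
    using w by (auto simp: w_eq chart_range_def \<theta>1_def \<theta>2_def)
  have inv: "chart_inv p w = (from_polar (fst p) r1 \<theta>1, from_polar (snd p) r2 \<theta>2)"
    by (simp add: w_eq chart_inv_def r1_def r2_def \<theta>1_def \<theta>2_def)
  note P1 = from_polar[OF p(1) r(1) \<theta>(1)] and P2 = from_polar[OF p(2) r(2) \<theta>(2)]
  have "chart p (chart_inv p w) = w"
    unfolding inv unfolding chart_def fst_conv snd_conv P1 P2 r w_eq
    using A_pos B_pos c_pos by (simp add: \<theta>1_def \<theta>2_def field_simps)
  moreover have "chart_inv p w \<in> chart_domain p"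
    by (simp add: inv chart_domain_def P1 P2)
  ultimately show "chart_inv p w \<in> chart_domain p \<and> chart p (chart_inv p w) = w" by simp
qed (use assms in \<open>auto intro: open_chart_domain open_chart_range smooth_chart_map smooth_chart_inv\<close>)

lemma cmod_square_deriv: "((\<lambda>z. (cmod z)\<^sup>2) has_derivative (\<lambda>X. 2 * Re (cnj z * X))) (at z)"
  unfolding cmod_power2 by (auto intro!: derivative_eq_intros)

lemma Im_Ln_deriv:
  assumes "z / p \<notin> \<real>\<^sub>\<le>\<^sub>0" "p \<noteq> 0"
  shows "((\<lambda>z. Im (Ln (z / p))) has_derivative (\<lambda>X. Im (X / z))) (at z)"
proof -
  have z: "z \<noteq> 0" using assms by auto
  have "((\<lambda>z. Ln (z / p)) has_field_derivative inverse z) (at z)"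
    using assms z by (auto intro!: derivative_eq_intros simp: field_simps)
  then have "((\<lambda>z. Ln (z / p)) has_derivative (\<lambda>X. X / z)) (at z)"
    unfolding has_field_derivative_def by (rule has_derivative_eq_rhs) (simp add: fun_eq_iff field_simps)
  then show ?thesis by (rule has_derivative_Im)
qed

lemma chart_deriv:
  assumes p: "fst p \<noteq> 0" "snd p \<noteq> 0" and q: "q \<in> chart_domain p"
  shows "(chart p has_derivative (\<lambda>X. (2 * c * A * Re (cnj (snd q) * snd X), - (2 * c * B * Re (cnj (fst q) * fst X)),
     Im (fst X / fst q) / (2 * B), (A * Im (fst X / fst q) + B * Im (snd X / snd q)) / (2 * c * A * B)))) (at q)"
proof -
  have fst': "(fst has_derivative fst) (at q)" and snd': "(snd has_derivative snd) (at q)"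
    by (auto intro: bounded_linear_imp_has_derivative bounded_linear_fst bounded_linear_snd)
  note N1 = has_derivative_compose[OF fst' cmod_square_deriv] and N2 = has_derivative_compose[OF snd' cmod_square_deriv]
  have L1: "((\<lambda>q. Im (Ln (fst q / fst p))) has_derivative (\<lambda>X. Im (fst X / fst q))) (at q)"
    and L2: "((\<lambda>q. Im (Ln (snd q / snd p))) has_derivative (\<lambda>X. Im (snd X / snd q))) (at q)"
    using q p by (auto simp: chart_domain_def intro!: has_derivative_compose[OF fst' Im_Ln_deriv]
        has_derivative_compose[OF snd' Im_Ln_deriv])
  have "(chart p has_derivative (\<lambda>X. (c * A * (2 * Re (cnj (snd q) * snd X)),
      - (c * (0 + B * (2 * Re (cnj (fst q) * fst X)))), Im (fst X / fst q) * inverse (2 * B),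
      (A * Im (fst X / fst q) + B * Im (snd X / snd q)) * inverse (2 * c * A * B)))) (at q)"
    unfolding chart_def[abs_def] divide_inverse[of _ "2 * B"] divide_inverse[of _ "2 * c * A * B"]
    by (intro has_derivative_Pair has_derivative_mult_right has_derivative_mult_left has_derivative_minus
        has_derivative_add has_derivative_const N1 N2 L1 L2)
  then show ?thesis
    unfolding divide_inverse[of _ "2 * B"] divide_inverse[of _ "2 * c * A * B"]
    by (rule has_derivative_eq_rhs) (rule ext, simp only: add_0 mult_ac)
qed

text \<open>Both sides are diagonal in the forms \<open>r1\<close>, \<open>r2\<close>, \<open>q1\<close>, \<open>q2\<close>, which are
  the real and imaginary parts of \<open>cnj z1\<close> and \<open>cnj z2\<close> times the coframe components, up to the
  factor \<open>f\<close> in the real parts.\<close>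

lemma metric_orthotoric:
  assumes p: "fst p \<noteq> 0" "snd p \<noteq> 0" and q: "q \<in> chart_domain p"
  shows "metric q X Y = orthotoric_metric (\<lambda>\<xi>. 4 * c * A * \<xi>) (\<lambda>\<eta>. 4 * c * B * \<eta> + 4 * c\<^sup>2 * B)
     (chart p q) (frechet_derivative (chart p) (at q) X) (frechet_derivative (chart p) (at q) Y)"
proof -
  define z1 z2 where "z1 = fst q" and "z2 = snd q"
  have z0: "z1 \<noteq> 0" "z2 \<noteq> 0" using q by (auto simp: z1_def z2_def chart_domain_def)
  define v u where "v = (cmod z1)\<^sup>2" and "u = (cmod z2)\<^sup>2"
  have pos: "v > 0" "u > 0" using z0 by (simp_all add: v_def u_def)
  define fq where "fq = 1 + A * u + B * v"
  have fq: "f q = fq"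
    by (simp add: f_def half_df_def fq_def u_def v_def z1_def z2_def cmod_def power2_eq_square)
  have fq0: "fq > 0" using f_pos[of q] by (simp add: fq)
  define r1 r2 s1 s2 where "r1 = (\<lambda>X::C2. Re (cnj z1 * fst X))" and "r2 = (\<lambda>X::C2. Re (cnj z2 * snd X))"
    and "s1 = (\<lambda>X::C2. Im (cnj z1 * fst X))" and "s2 = (\<lambda>X::C2. Im (cnj z2 * snd X))"
  define q1 q2 where "q1 = (\<lambda>X. (1 + A * u) * s1 X + B * v * s2 X)" and "q2 = (\<lambda>X. (1 + B * v) * s2 X + A * u * s1 X)"
  have Im_div: "Im (x / z) = Im (cnj z * x) / (cmod z)\<^sup>2" for x z
    by (simp add: Im_divide cmod_power2)
  have inner_mult: "(cmod z)\<^sup>2 * (x \<bullet> y) = Re (cnj z * x) * Re (cnj z * y) + Im (cnj z * x) * Im (cnj z * y)" for x y z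
    unfolding cmod_power2 by (simp add: inner_complex_def algebra_simps power2_eq_square)
  have kappa: "kappa q X = s1 X - s2 X" for X
    by (simp add: kappa_def s1_def s2_def z1_def z2_def)
  have "cnj z1 * fst (coframe q X) = Complex (fq * r1 X) (q1 X)" for X
  proof -
    have "cnj z1 * fst (coframe q X) = fq * (cnj z1 * fst X) - \<i> * B * kappa q X * (z1 * cnj z1)"
      by (simp add: coframe_def twist_def fq scaleR_conv_of_real z1_def algebra_simps)
    also have "z1 * cnj z1 = of_real v" unfolding v_def complex_norm_square ..
    finally show ?thesis
      by (simp add: complex_eq_iff r1_def q1_def kappa s1_def fq_def algebra_simps)
  qed
  then have 1: "v * (fst (coframe q X) \<bullet> fst (coframe q Y)) = fq\<^sup>2 * r1 X * r1 Y + q1 X * q1 Y" for X Y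
    unfolding v_def inner_mult by (simp add: power2_eq_square)
  have "cnj z2 * snd (coframe q X) = Complex (fq * r2 X) (q2 X)" for X
  proof -
    have "cnj z2 * snd (coframe q X) = fq * (cnj z2 * snd X) + \<i> * A * kappa q X * (z2 * cnj z2)"
      by (simp add: coframe_def twist_def fq scaleR_conv_of_real z2_def algebra_simps)
    also have "z2 * cnj z2 = of_real u" unfolding u_def complex_norm_square ..
    finally show ?thesis
      by (simp add: complex_eq_iff r2_def q2_def kappa s2_def fq_def algebra_simps)
  qed
  then have 2: "u * (snd (coframe q X) \<bullet> snd (coframe q Y)) = fq\<^sup>2 * r2 X * r2 Y + q2 X * q2 Y" for X Y
    unfolding u_def inner_mult by (simp add: power2_eq_square)
  have lhs: "metric q X Y = c / fq * ((fq\<^sup>2 * r1 X * r1 Y + q1 X * q1 Y) / v + (fq\<^sup>2 * r2 X * r2 Y + q2 X * q2 Y) / u)"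
    unfolding 1[symmetric] 2[symmetric] using pos by (simp add: metric_def s_def fq inner_prod_def)
  define \<xi> \<eta> where "\<xi> = c * A * u" and "\<eta> = - (c * (1 + B * v))"
  have D: "frechet_derivative (chart p) (at q) X = (2 * c * A * r2 X, - (2 * c * B * r1 X), s1 X / v / (2 * B),
      (A * (s1 X / v) + B * (s2 X / u)) / (2 * c * A * B))" for X
    unfolding frechet_derivative_eqI[OF chart_deriv[OF p q]] Im_div
    by (simp add: r1_def r2_def s1_def s2_def z1_def z2_def u_def v_def)
  have dt1: "s1 X / v / (2 * B) + \<eta> * ((A * (s1 X / v) + B * (s2 X / u)) / (2 * c * A * B)) = - (q2 X / (2 * A * u))" for X
    using A_pos B_pos c_pos pos by (simp add: q2_def \<eta>_def field_simps)
  have dt2: "s1 X / v / (2 * B) + \<xi> * ((A * (s1 X / v) + B * (s2 X / u)) / (2 * c * A * B)) = q1 X / (2 * B * v)" for X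
    using A_pos B_pos c_pos pos by (simp add: q1_def \<xi>_def field_simps)
  have diff: "\<xi> - \<eta> = c * fq" by (simp add: \<xi>_def \<eta>_def fq_def algebra_simps)
  have F: "4 * c * A * \<xi> = 4 * c\<^sup>2 * A\<^sup>2 * u" and G: "4 * c * B * \<eta> + 4 * c\<^sup>2 * B = - (4 * c\<^sup>2 * B\<^sup>2 * v)"
    by (simp_all add: \<xi>_def \<eta>_def algebra_simps power2_eq_square)
  obtain t z where chart: "chart p q = (\<xi>, \<eta>, t, z)"
    by (simp add: chart_def \<xi>_def \<eta>_def u_def v_def z1_def z2_def)
  show ?thesis
    unfolding lhs D chart orthotoric_metric_def prod.case dt1 dt2 diff F G
    using A_pos B_pos c_pos pos fq0 by (simp add: field_simps power2_eq_square)
qed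

lemma locally_orthotoric:
  "locally_orthotoric {p. fst p \<noteq> 0 \<and> snd p \<noteq> 0} metric (\<lambda>\<xi>. 4 * c * A * \<xi>) (\<lambda>\<eta>. 4 * c * B * \<eta> + 4 * c\<^sup>2 * B)"
  unfolding locally_orthotoric_def
proof (intro ballI exI conjI allI)
  fix p :: C2 assume "p \<in> {p. fst p \<noteq> 0 \<and> snd p \<noteq> 0}"
  then have p: "fst p \<noteq> 0" "snd p \<noteq> 0" by auto
  show "p \<in> chart_domain p" using p by (simp add: chart_domain_def)
  show "chart_domain p \<subseteq> {p. fst p \<noteq> 0 \<and> snd p \<noteq> 0}" by (auto simp: chart_domain_def)
  show "smooth_chart (chart_domain p) (chart p)" by (rule smooth_chart[OF p])
  fix q assume q: "q \<in> chart_domain p"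
  then have pos: "(cmod (fst q))\<^sup>2 > 0" "(cmod (snd q))\<^sup>2 > 0" by (auto simp: chart_domain_def)
  have "c * A * (cmod (snd q))\<^sup>2 > 0" "c * B * (cmod (fst q))\<^sup>2 > 0"
    using pos A_pos B_pos c_pos by (simp_all del: zero_less_power2)
  moreover have "c * (c * A * (cmod (snd q))\<^sup>2) * A > 0" "c * (c * B * (cmod (fst q))\<^sup>2) * B > 0"
    using calculation A_pos B_pos c_pos by (metis mult_pos_pos)+
  ultimately show "case chart p q of (\<xi>, \<eta>, t, z) \<Rightarrow> \<xi> > \<eta> \<and> 4 * c * A * \<xi> > 0 \<and> 4 * c * B * \<eta> + 4 * c\<^sup>2 * B < 0"
    using c_pos by (simp add: chart_def algebra_simps power2_eq_square)
  show "metric q X Y = orthotoric_metric (\<lambda>\<xi>. 4 * c * A * \<xi>) (\<lambda>\<eta>. 4 * c * B * \<eta> + 4 * c\<^sup>2 * B)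
     (chart p q) (frechet_derivative (chart p) (at q) X) (frechet_derivative (chart p) (at q) Y)" for X Y
    by (rule metric_orthotoric[OF p q])
qed

end

section \<open>Toric description of the generalized Taub-NUT surface\<close>

lemma grad_gSigma:
  assumes h: "(h has_derivative (\<lambda>(dx, dy). hx * dx + hy * dy)) (at (x, y))"
    and g: "\<And>a b a' b'. gtn_gSigma \<alpha> \<beta> (x, y) (a, b) (a', b') = r * (a * a' + b * b')" and r: "r > 0"
  shows "grad (gtn_gSigma \<alpha> \<beta>) h (x, y) = (hx / r, hy / r)"
  unfolding grad_def
proof (rule the_equality)
  show "\<forall>X. gtn_gSigma \<alpha> \<beta> (x, y) (hx / r, hy / r) X = frechet_derivative h (at (x, y)) X"
    using r by (auto simp: g frechet_derivative_eqI[OF h] field_simps)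
  fix W assume W: "\<forall>X. gtn_gSigma \<alpha> \<beta> (x, y) W X = frechet_derivative h (at (x, y)) X"
  show "W = (hx / r, hy / r)"
    using W[rule_format, of "(1, 0)"] W[rule_format, of "(0, 1)"] r
    by (cases W) (auto simp: g frechet_derivative_eqI[OF h] field_simps)
qed

text \<open>Gradients of a metric conformal to the Euclidean one by the factor \<open>r\<close> are Euclidean gradients divided by
  \<open>r\<close>.\<close>

lemma gram_eq:
  assumes f: "(f has_derivative (\<lambda>(dx, dy). fx * dx + fy * dy)) (at (x, y))"
    and h: "(h has_derivative (\<lambda>(dx, dy). hx * dx + hy * dy)) (at (x, y))"
    and g: "\<And>a b a' b'. gtn_gSigma \<alpha> \<beta> (x, y) (a, b) (a', b') = r * (a * a' + b * b')" and r: "r > 0"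
  shows "gtn_gram \<alpha> \<beta> f h (x, y) = (fx * hx + fy * hy) / r"
  using r unfolding gtn_gram_def grad_gSigma[OF f g r] grad_gSigma[OF h g r]
  by (simp add: g field_simps)

text \<open>The values of the parameters that belong to \<open>\<alpha>\<close> and \<open>\<beta>\<close>, namely
  \<open>A = 1 + k\<close> and \<open>B = 1 - k\<close>, so that \<open>A + B = 2\<close>.\<close>

locale gtn = taub_nut A B "2 / M" for A B M :: real +
  fixes \<alpha> \<beta> :: real
  assumes AB: "A + B = 2" and \<alpha>: "\<alpha> = sqrt 2 * M * A" and \<beta>: "\<beta> = sqrt 2 * M * B"
begin

lemma M_pos: "M > 0" using c_pos by simp

lemma gtn_M: "gtn_M \<alpha> \<beta> = M" and gtn_k: "gtn_k \<alpha> \<beta> = (A - B) / 2"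
proof -
  have sum: "\<alpha> + \<beta> = sqrt 2 * M * 2" and diff: "\<alpha> - \<beta> = sqrt 2 * M * (A - B)"
    unfolding \<alpha> \<beta> AB[symmetric] by (simp_all add: algebra_simps)
  show "gtn_M \<alpha> \<beta> = M" unfolding gtn_M_def sum by simp
  show "gtn_k \<alpha> \<beta> = (A - B) / 2" unfolding gtn_k_def sum diff using M_pos by simp
qed

text \<open>The half plane is parametrized by the moduli \<open>u = |z2|\<close> and \<open>v = |z1|\<close> through
  \<open>y + \<i> x = (u + \<i> v)\<^sup>2 / (2 * M)\<close>. This map is conformal and removes the square root
  \<open>sqrt (x\<^sup>2 + y\<^sup>2)\<close>. The angles \<open>\<phi>\<close> and \<open>\<theta>\<close> are the
  arguments of \<open>z1\<close> and \<open>z2\<close>; \<open>tangent\<close> is the differential of the parametrization.\<close>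

definition point :: "real \<Rightarrow> real \<Rightarrow> real \<Rightarrow> real \<Rightarrow> R4" where
  "point u v \<phi> \<theta> = (u * v / M, (u\<^sup>2 - v\<^sup>2) / (2 * M), sqrt 2 * \<phi>, sqrt 2 * \<theta>)"

definition tangent :: "real \<Rightarrow> real \<Rightarrow> R4 \<Rightarrow> R4" where
  "tangent u v = (\<lambda>(du, dv, d\<phi>, d\<theta>).
     ((u * dv + v * du) / M, (u * du - v * dv) / M, sqrt 2 * d\<phi>, sqrt 2 * d\<theta>))"

context
  fixes u v :: real
  assumes u: "u > 0" and v: "v > 0"
begin

definition x where "x = u * v / M"
definition y where "y = (u\<^sup>2 - v\<^sup>2) / (2 * M)"
definition \<rho> where "\<rho> = (u\<^sup>2 + v\<^sup>2) / (2 * M)"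
definition fuv where "fuv = 1 + A * u\<^sup>2 + B * v\<^sup>2"

lemma uv_pos: "u\<^sup>2 + v\<^sup>2 > 0" using u v by (simp add: add_pos_pos)

lemma uv_nz: "u\<^sup>2 + v\<^sup>2 \<noteq> 0" using uv_pos by (metis less_irrefl)

lemma fuv_pos: "fuv > 0"
  unfolding fuv_def using u v A_pos B_pos by (simp add: add_pos_pos)

lemma \<rho>_pos: "\<rho> > 0" using uv_pos M_pos by (simp add: \<rho>_def)

lemma sqrt_xy: "sqrt (x\<^sup>2 + y\<^sup>2) = \<rho>"
proof (rule real_sqrt_unique)
  show "\<rho>\<^sup>2 = x\<^sup>2 + y\<^sup>2"
    using M_pos by (simp add: x_def y_def \<rho>_def field_simps power2_eq_square)
qed (use \<rho>_pos in simp)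

lemma xy_pos: "x\<^sup>2 + y\<^sup>2 > 0"
  using sqrt_xy \<rho>_pos by (metis real_sqrt_gt_0_iff)

lemma sqrt_deriv: "((\<lambda>p. sqrt ((fst p)\<^sup>2 + (snd p)\<^sup>2)) has_derivative (\<lambda>p. (x * fst p + y * snd p) / \<rho>)) (at (x, y))"
  using xy_pos \<rho>_pos by (auto intro!: derivative_eq_intros simp: sqrt_xy field_simps)

lemma snd_deriv: "(snd has_derivative snd) (at p)"
  by (intro bounded_linear_imp_has_derivative bounded_linear_snd)

lemma square_deriv: "((\<lambda>p. (fst p)\<^sup>2) has_derivative (\<lambda>p. 2 * x * fst p)) (at (x, y))"
  by (auto intro!: derivative_eq_intros)

text \<open>The partial derivatives of the two potentials, expressed through the moduli.\<close>

definition "P1x = (2 * u * v / (u\<^sup>2 + v\<^sup>2) + 2 * A * u * v) / sqrt 2"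
definition "P1y = - (2 * v\<^sup>2 / (u\<^sup>2 + v\<^sup>2)) / sqrt 2"
definition "P2x = (2 * u * v / (u\<^sup>2 + v\<^sup>2) + 2 * B * u * v) / sqrt 2"
definition "P2y = (2 * u\<^sup>2 / (u\<^sup>2 + v\<^sup>2)) / sqrt 2"

lemma xy_\<rho>: "x / \<rho> = 2 * u * v / (u\<^sup>2 + v\<^sup>2)" "y / \<rho> = (u\<^sup>2 - v\<^sup>2) / (u\<^sup>2 + v\<^sup>2)"
  using M_pos uv_pos by (simp_all add: x_def y_def \<rho>_def)

lemma \<alpha>\<beta>_x: "\<alpha> * x = 2 * A * u * v / sqrt 2" "\<beta> * x = 2 * B * u * v / sqrt 2"
  using M_pos by (simp_all add: x_def \<alpha> \<beta> field_simps)

lemma potential_combine: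
  "1 / sqrt 2 * (- dy + (X * dx + (1 - W) * dy)) + R / sqrt 2 * dx = (X + R) / sqrt 2 * dx + - W / sqrt 2 * dy"
  "1 / sqrt 2 * (dy + (X * dx + (W - 1) * dy)) + R / sqrt 2 * dx = (X + R) / sqrt 2 * dx + W / sqrt 2 * dy"
  for X W R dx dy :: real
  by (simp_all add: field_simps)

lemma psi1_deriv: "(gtn_psi1 \<alpha> has_derivative (\<lambda>(dx, dy). P1x * dx + P1y * dy)) (at (x, y))"
proof -
  have "((\<lambda>p. 1 / sqrt 2 * (- snd p + sqrt ((fst p)\<^sup>2 + (snd p)\<^sup>2)) + \<alpha> / 2 * (fst p)\<^sup>2) has_derivative
      (\<lambda>p. 1 / sqrt 2 * (- snd p + (x * fst p + y * snd p) / \<rho>) + \<alpha> / 2 * (2 * x * fst p))) (at (x, y))"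
    by (intro has_derivative_add has_derivative_mult_right has_derivative_minus snd_deriv sqrt_deriv square_deriv)
  moreover have "1 / sqrt 2 * (- dy + (x * dx + y * dy) / \<rho>) + \<alpha> / 2 * (2 * x * dx) = P1x * dx + P1y * dy" for dx dy
  proof -
    have "(x * dx + y * dy) / \<rho> = (x / \<rho>) * dx + (y / \<rho>) * dy" by (simp add: add_divide_distrib)
    moreover have "(u\<^sup>2 - v\<^sup>2) / (u\<^sup>2 + v\<^sup>2) = 1 - 2 * v\<^sup>2 / (u\<^sup>2 + v\<^sup>2)"
      using uv_nz by (simp add: field_simps)
    moreover have "\<alpha> / 2 * (2 * x * dx) = 2 * A * u * v / sqrt 2 * dx" by (simp flip: \<alpha>\<beta>_x)
    ultimately show ?thesis unfolding xy_\<rho> P1x_def P1y_def by (simp only: potential_combine)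
  qed
  ultimately show ?thesis unfolding gtn_psi1_def case_prod_beta by (simp only:)
qed

lemma psi2_deriv: "(gtn_psi2 \<beta> has_derivative (\<lambda>(dx, dy). P2x * dx + P2y * dy)) (at (x, y))"
proof -
  have "((\<lambda>p. 1 / sqrt 2 * (snd p + sqrt ((fst p)\<^sup>2 + (snd p)\<^sup>2)) + \<beta> / 2 * (fst p)\<^sup>2) has_derivative
      (\<lambda>p. 1 / sqrt 2 * (snd p + (x * fst p + y * snd p) / \<rho>) + \<beta> / 2 * (2 * x * fst p))) (at (x, y))"
    by (intro has_derivative_add has_derivative_mult_right snd_deriv sqrt_deriv square_deriv)
  moreover have "1 / sqrt 2 * (dy + (x * dx + y * dy) / \<rho>) + \<beta> / 2 * (2 * x * dx) = P2x * dx + P2y * dy" for dx dy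
  proof -
    have "(x * dx + y * dy) / \<rho> = (x / \<rho>) * dx + (y / \<rho>) * dy" by (simp add: add_divide_distrib)
    moreover have "(u\<^sup>2 - v\<^sup>2) / (u\<^sup>2 + v\<^sup>2) = 2 * u\<^sup>2 / (u\<^sup>2 + v\<^sup>2) - 1"
      using uv_nz by (simp add: field_simps)
    moreover have "\<beta> / 2 * (2 * x * dx) = 2 * B * u * v / sqrt 2 * dx" by (simp flip: \<alpha>\<beta>_x)
    ultimately show ?thesis unfolding xy_\<rho> P2x_def P2y_def by (simp only: potential_combine)
  qed
  ultimately show ?thesis unfolding gtn_psi2_def case_prod_beta by (simp only:)
qed

lemma gSigma: "gtn_gSigma \<alpha> \<beta> (x, y) (dx, dy) (dx', dy') = fuv / \<rho> * (dx * dx' + dy * dy')"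
proof -
  have "2 * M * ((A - B) / 2 * y + \<rho>) = (A - B) / 2 * (u\<^sup>2 - v\<^sup>2) + (A + B) / 2 * (u\<^sup>2 + v\<^sup>2)"
    using M_pos AB by (simp add: y_def \<rho>_def field_simps)
  also have "1 + \<dots> = fuv" by (simp add: fuv_def field_simps)
  finally show ?thesis by (simp add: gtn_gSigma_def gtn_M gtn_k sqrt_xy)
qed

lemma conformal_factor_pos: "fuv / \<rho> > 0" using fuv_pos \<rho>_pos by simp

lemmas grams = gram_eq[OF psi1_deriv psi1_deriv gSigma conformal_factor_pos]
  gram_eq[OF psi1_deriv psi2_deriv gSigma conformal_factor_pos]
  gram_eq[OF psi2_deriv psi1_deriv gSigma conformal_factor_pos]
  gram_eq[OF psi2_deriv psi2_deriv gSigma conformal_factor_pos]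

text \<open>Rotated back by the arguments of \<open>z1\<close> and \<open>z2\<close>, the coframe components are
  \<open>f dv + \<i> n\<close> and \<open>f du + \<i> m\<close> (see \<open>coframe_cover\<close>); the gram matrix of
  the torus directions is the one of the forms \<open>n\<close> and \<open>m\<close>.\<close>

definition "n d\<phi> d\<theta> = v * ((1 + A * u\<^sup>2) * d\<phi> + B * u\<^sup>2 * d\<theta>)"
definition "m d\<phi> d\<theta> = u * ((1 + B * v\<^sup>2) * d\<theta> + A * v\<^sup>2 * d\<phi>)"

lemma P_products:
  "P1x * P1x + P1y * P1y = 2 * ((v * (1 + A * u\<^sup>2))\<^sup>2 + (A * u * v\<^sup>2)\<^sup>2) / (u\<^sup>2 + v\<^sup>2)"
  "P1x * P2x + P1y * P2y = 2 * (v * (1 + A * u\<^sup>2) * (B * u\<^sup>2 * v) + A * u * v\<^sup>2 * (u * (1 + B * v\<^sup>2))) / (u\<^sup>2 + v\<^sup>2)"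
  "P2x * P2x + P2y * P2y = 2 * ((u * (1 + B * v\<^sup>2))\<^sup>2 + (B * v * u\<^sup>2)\<^sup>2) / (u\<^sup>2 + v\<^sup>2)"
proof -
  define h where "h = 1 / (u\<^sup>2 + v\<^sup>2)"
  have h: "h * (u\<^sup>2 + v\<^sup>2) = 1" and div: "z / (u\<^sup>2 + v\<^sup>2) = z * h" for z
    using uv_nz by (simp_all add: h_def)
  have half: "a / sqrt 2 * (b / sqrt 2) + a' / sqrt 2 * (b' / sqrt 2) = 2 * z * h" if "a * b + a' * b' = 4 * z * h"
    for a b a' b' z using that by (simp flip: add_divide_distrib)
  show "P1x * P1x + P1y * P1y = 2 * ((v * (1 + A * u\<^sup>2))\<^sup>2 + (A * u * v\<^sup>2)\<^sup>2) / (u\<^sup>2 + v\<^sup>2)"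
    "P1x * P2x + P1y * P2y = 2 * (v * (1 + A * u\<^sup>2) * (B * u\<^sup>2 * v) + A * u * v\<^sup>2 * (u * (1 + B * v\<^sup>2))) / (u\<^sup>2 + v\<^sup>2)"
    "P2x * P2x + P2y * P2y = 2 * ((u * (1 + B * v\<^sup>2))\<^sup>2 + (B * v * u\<^sup>2)\<^sup>2) / (u\<^sup>2 + v\<^sup>2)"
    unfolding P1x_def P1y_def P2x_def P2y_def div
    by (rule half, use h in algebra)+
qed

lemma model_metric:
  "gtn_model_metric \<alpha> \<beta> (point u v \<phi> \<theta>) (tangent u v (du, dv, d\<phi>, d\<theta>)) (tangent u v (du', dv', d\<phi>', d\<theta>')) =
     2 / M / fuv * (fuv\<^sup>2 * dv * dv' + n d\<phi> d\<theta> * n d\<phi>' d\<theta>' + fuv\<^sup>2 * du * du' + m d\<phi> d\<theta> * m d\<phi>' d\<theta>')"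
proof -
  have \<Sigma>: "fuv / \<rho> * ((u * dv + v * du) / M * ((u * dv' + v * du') / M) + (u * du - v * dv) / M * ((u * du' - v * dv') / M))
      = 2 / M * fuv * (du * du' + dv * dv')"
  proof -
    have "(u * dv + v * du) / M * ((u * dv' + v * du') / M) + (u * du - v * dv) / M * ((u * du' - v * dv') / M)
      = (u\<^sup>2 + v\<^sup>2) / M\<^sup>2 * (du * du' + dv * dv')"
      using M_pos by (simp add: field_simps power2_eq_square)
    moreover have "fuv / (N / (2 * M)) * (N / M\<^sup>2 * w) = 2 / M * fuv * w" if "N \<noteq> 0" for N w
      using M_pos that by (simp add: field_simps power2_eq_square)
    ultimately show ?thesis using uv_nz by (simp only: \<rho>_def)
  qed
  have G: "2 * r / (u\<^sup>2 + v\<^sup>2) / (fuv / \<rho>) * (sqrt 2 * a * (sqrt 2 * b)) = 2 / M / fuv * (r * a * b)" for r a b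
  proof -
    have "sqrt 2 * a * (sqrt 2 * b) = 2 * (a * b)" by simp
    moreover have "2 * r / N / (fuv / (N / (2 * M))) * (2 * (a * b)) = 2 / M / fuv * (r * a * b)" if "N \<noteq> 0" for N
      using that M_pos fuv_pos by (simp add: field_simps)
    ultimately show ?thesis using uv_nz by (simp only: \<rho>_def)
  qed
  have P21: "P2x * P1x + P2y * P1y = P1x * P2x + P1y * P2y" by (simp add: mult.commute)
  have "gtn_model_metric \<alpha> \<beta> (point u v \<phi> \<theta>) (tangent u v (du, dv, d\<phi>, d\<theta>)) (tangent u v (du', dv', d\<phi>', d\<theta>')) =
      2 / M * fuv * (du * du' + dv * dv')
    + 2 / M / fuv * (((v * (1 + A * u\<^sup>2))\<^sup>2 + (A * u * v\<^sup>2)\<^sup>2) * d\<phi> * d\<phi>')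
    + 2 / M / fuv * ((v * (1 + A * u\<^sup>2) * (B * u\<^sup>2 * v) + A * u * v\<^sup>2 * (u * (1 + B * v\<^sup>2))) * d\<phi> * d\<theta>')
    + 2 / M / fuv * ((v * (1 + A * u\<^sup>2) * (B * u\<^sup>2 * v) + A * u * v\<^sup>2 * (u * (1 + B * v\<^sup>2))) * d\<theta> * d\<phi>')
    + 2 / M / fuv * (((u * (1 + B * v\<^sup>2))\<^sup>2 + (B * v * u\<^sup>2)\<^sup>2) * d\<theta> * d\<theta>')"
    unfolding gtn_model_metric_def point_def tangent_def prod.case x_def[symmetric] y_def[symmetric]
      gSigma grams P21 P_products G \<Sigma> ..
  also have "\<dots> = 2 / M / fuv * (fuv\<^sup>2 * dv * dv' + n d\<phi> d\<theta> * n d\<phi>' d\<theta>' + fuv\<^sup>2 * du * du' + m d\<phi> d\<theta> * m d\<phi>' d\<theta>')"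
  proof -
    have "2 / M * fuv * (du * du' + dv * dv') = 2 / M / fuv * (fuv\<^sup>2 * (du * du' + dv * dv'))"
      using fuv_pos by (simp add: power2_eq_square)
    then show ?thesis
      unfolding n_def m_def by algebra
  qed
  finally show ?thesis .
qed

lemma dpsi_tangent:
  "P1x * ((u * dv + v * du) / M) + P1y * ((u * du - v * dv) / M) =
     sqrt 2 / M * (v * (1 + A * u\<^sup>2) * dv + A * u * v\<^sup>2 * du)"
  "P2x * ((u * dv + v * du) / M) + P2y * ((u * du - v * dv) / M) =
     sqrt 2 / M * (u * (1 + B * v\<^sup>2) * du + B * v * u\<^sup>2 * dv)"
proof -
  define h where "h = 1 / (u\<^sup>2 + v\<^sup>2)"
  have h: "h * (u\<^sup>2 + v\<^sup>2) = 1" and div: "z / (u\<^sup>2 + v\<^sup>2) = z * h" for z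
    using uv_nz by (simp_all add: h_def)
  have root: "a / sqrt 2 * (b / M) + a' / sqrt 2 * (b' / M) = sqrt 2 / M * z" if "a * b + a' * b' = 2 * z" for a b a' b' z
  proof -
    have "a / sqrt 2 * (b / M) + a' / sqrt 2 * (b' / M) = (a * b + a' * b') / (sqrt 2 * M)"
      by (simp add: add_divide_distrib)
    also have "\<dots> = (2 / sqrt 2) * (z / M)" unfolding that by simp
    finally show ?thesis unfolding real_div_sqrt[of 2, simplified] by simp
  qed
  show "P1x * ((u * dv + v * du) / M) + P1y * ((u * du - v * dv) / M) =
     sqrt 2 / M * (v * (1 + A * u\<^sup>2) * dv + A * u * v\<^sup>2 * du)"
    "P2x * ((u * dv + v * du) / M) + P2y * ((u * du - v * dv) / M) =
     sqrt 2 / M * (u * (1 + B * v\<^sup>2) * du + B * v * u\<^sup>2 * dv)"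
    unfolding P1x_def P1y_def P2x_def P2y_def div by (rule root, use h in algebra)+
qed

lemma model_form:
  "gtn_model_form \<alpha> \<beta> (point u v \<phi> \<theta>) (tangent u v (du, dv, d\<phi>, d\<theta>)) (tangent u v (du', dv', d\<phi>', d\<theta>')) =
     2 / M * (dv * n d\<phi>' d\<theta>' - n d\<phi> d\<theta> * dv' + du * m d\<phi>' d\<theta>' - m d\<phi> d\<theta> * du')"
proof -
  have root: "sqrt 2 / M * a * (sqrt 2 * b) = 2 / M * (a * b)" for a b by simp
  show ?thesis
    unfolding gtn_model_form_def point_def tangent_def prod.case x_def[symmetric] y_def[symmetric] Let_def
      frechet_derivative_eqI[OF psi1_deriv] frechet_derivative_eqI[OF psi2_deriv] dpsi_tangent root
    unfolding n_def m_def by algebra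
qed

lemma sqrt_compose_deriv:
  assumes "(h has_derivative h') (at p)" "h p = w\<^sup>2" "w > 0"
  shows "((\<lambda>q. sqrt (h q)) has_derivative (\<lambda>X. h' X / (2 * w))) (at p)"
  using assms by (auto intro!: derivative_eq_intros simp: fun_eq_iff field_simps)

lemma radii: "M * (\<rho> - y) = v\<^sup>2" "M * (\<rho> + y) = u\<^sup>2"
  using M_pos by (simp_all add: \<rho>_def y_def field_simps)

lemma cover_point: "gtn_cover \<alpha> \<beta> (point u v \<phi> \<theta>) = (of_real v * cis \<phi>, of_real u * cis \<theta>)"
  unfolding gtn_cover_def point_def prod.case Let_def x_def[symmetric] y_def[symmetric] sqrt_xy gtn_M radii
  using u v by simp

lemma cover_deriv:
  "frechet_derivative (gtn_cover \<alpha> \<beta>) (at (point u v \<phi> \<theta>)) (tangent u v (du, dv, d\<phi>, d\<theta>)) =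
     (Complex dv (v * d\<phi>) * cis \<phi>, Complex du (u * d\<theta>) * cis \<theta>)"
proof -
  let ?q = "point u v \<phi> \<theta>"
  have proj: "((\<lambda>q::R4. (fst q, fst (snd q))) has_derivative (\<lambda>q. (fst q, fst (snd q)))) (at ?q)"
    "((\<lambda>q::R4. fst (snd q)) has_derivative (\<lambda>q. fst (snd q))) (at ?q)"
    "((\<lambda>q::R4. fst (snd (snd q))) has_derivative (\<lambda>q. fst (snd (snd q)))) (at ?q)"
    "((\<lambda>q::R4. snd (snd (snd q))) has_derivative (\<lambda>q. snd (snd (snd q)))) (at ?q)"
    by (auto intro!: derivative_eq_intros)
  have q: "(fst ?q, fst (snd ?q)) = (x, y)" "fst (snd (snd ?q)) = sqrt 2 * \<phi>" "snd (snd (snd ?q)) = sqrt 2 * \<theta>"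
    by (simp_all add: point_def x_def y_def)
  have R: "((\<lambda>q::R4. sqrt ((fst q)\<^sup>2 + (fst (snd q))\<^sup>2)) has_derivative
      (\<lambda>X. (x * fst X + y * fst (snd X)) / \<rho>)) (at ?q)"
    using has_derivative_compose[OF proj(1) sqrt_deriv[folded q(1)]] by simp
  have V: "((\<lambda>q::R4. sqrt (M * (sqrt ((fst q)\<^sup>2 + (fst (snd q))\<^sup>2) - fst (snd q)))) has_derivative
      (\<lambda>X. M * ((x * fst X + y * fst (snd X)) / \<rho> - fst (snd X)) / (2 * v))) (at ?q)"
    using q radii sqrt_xy v by (intro sqrt_compose_deriv has_derivative_mult_right has_derivative_diff R proj) auto
  have U: "((\<lambda>q::R4. sqrt (M * (sqrt ((fst q)\<^sup>2 + (fst (snd q))\<^sup>2) + fst (snd q)))) has_derivative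
      (\<lambda>X. M * ((x * fst X + y * fst (snd X)) / \<rho> + fst (snd X)) / (2 * u))) (at ?q)"
    using q radii sqrt_xy u by (intro sqrt_compose_deriv has_derivative_mult_right has_derivative_add R proj) auto
  have cancel: "sqrt 2 * r * inverse (sqrt 2) = r" for r by simp
  have C1: "((\<lambda>q::R4. cis (fst (snd (snd q)) / sqrt 2)) has_derivative
      (\<lambda>X. (fst (snd (snd X)) / sqrt 2) *\<^sub>R (\<i> * cis \<phi>))) (at ?q)"
    using has_derivative_cis[OF has_derivative_mult_left[OF proj(3), of "inverse (sqrt 2)"]]
    unfolding q cancel divide_inverse .
  have C2: "((\<lambda>q::R4. cis (snd (snd (snd q)) / sqrt 2)) has_derivative
      (\<lambda>X. (snd (snd (snd X)) / sqrt 2) *\<^sub>R (\<i> * cis \<theta>))) (at ?q)"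
    using has_derivative_cis[OF has_derivative_mult_left[OF proj(4), of "inverse (sqrt 2)"]]
    unfolding q cancel divide_inverse .
  have val: "sqrt (M * (sqrt ((fst ?q)\<^sup>2 + (fst (snd ?q))\<^sup>2) - fst (snd ?q))) = v"
    "sqrt (M * (sqrt ((fst ?q)\<^sup>2 + (fst (snd ?q))\<^sup>2) + fst (snd ?q))) = u"
    "fst (snd (snd ?q)) / sqrt 2 = \<phi>" "snd (snd (snd ?q)) / sqrt 2 = \<theta>"
    using q sqrt_xy radii u v by auto
  note D = has_derivative_Pair[OF has_derivative_mult[OF has_derivative_of_real[OF V] C1]
      has_derivative_mult[OF has_derivative_of_real[OF U] C2], unfolded val]
  have cover: "gtn_cover \<alpha> \<beta> = (\<lambda>q. (of_real (sqrt (M * (sqrt ((fst q)\<^sup>2 + (fst (snd q))\<^sup>2) - fst (snd q)))) *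
        cis (fst (snd (snd q)) / sqrt 2), of_real (sqrt (M * (sqrt ((fst q)\<^sup>2 + (fst (snd q))\<^sup>2) + fst (snd q)))) *
        cis (snd (snd (snd q)) / sqrt 2)))"
    by (auto simp: gtn_cover_def gtn_M Let_def fun_eq_iff)
  have d\<rho>: "(x * ((u * dv + v * du) / M) + y * ((u * du - v * dv) / M)) / \<rho> = (u * du + v * dv) / M"
  proof -
    have "x * ((u * dv + v * du) / M) + y * ((u * du - v * dv) / M) = \<rho> * ((u * du + v * dv) / M)"
      unfolding x_def y_def \<rho>_def using M_pos by (simp add: field_simps power2_eq_square)
    then show ?thesis using \<rho>_pos by simp
  qed
  have dv: "M * ((u * du + v * dv) / M - (u * du - v * dv) / M) / (2 * v) = dv"
    "M * ((u * du + v * dv) / M + (u * du - v * dv) / M) / (2 * u) = du"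
    using M_pos u v by (simp_all add: field_simps)
  have "sqrt 2 * r / sqrt 2 = r" for r by simp
  then show ?thesis
    unfolding frechet_derivative_eqI[OF D[folded cover]] tangent_def prod.case fst_conv snd_conv d\<rho> dv
    by (simp add: Complex_eq scaleR_conv_of_real algebra_simps)
qed

lemma coframe_cover:
  assumes p: "p = (of_real v * cis \<phi>, of_real u * cis \<theta>)"
  shows "coframe p (Complex dv (v * d\<phi>) * cis \<phi>, Complex du (u * d\<theta>) * cis \<theta>) =
    (Complex (fuv * dv) (n d\<phi> d\<theta>) * cis \<phi>, Complex (fuv * du) (m d\<phi> d\<theta>) * cis \<theta>)"
proof -
  let ?X = "(Complex dv (v * d\<phi>) * cis \<phi>, Complex du (u * d\<theta>) * cis \<theta>)"
  have cc: "cnj (of_real r * cis t) * (w * cis t) = of_real r * w" for r t w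
    by (simp add: cis_cnj cis_mult mult_ac)
  have fp: "f p = fuv"
    unfolding f_def half_df_def p fst_conv snd_conv cc by (simp add: fuv_def power2_eq_square)
  have kappa: "kappa p ?X = v\<^sup>2 * d\<phi> - u\<^sup>2 * d\<theta>"
    unfolding kappa_def p fst_conv snd_conv cc by (simp add: power2_eq_square)
  have "coframe p ?X = (Complex (fuv * dv) (fuv * (v * d\<phi>) - B * v * (v\<^sup>2 * d\<phi> - u\<^sup>2 * d\<theta>)) * cis \<phi>,
      Complex (fuv * du) (fuv * (u * d\<theta>) + A * u * (v\<^sup>2 * d\<phi> - u\<^sup>2 * d\<theta>)) * cis \<theta>)"
    unfolding coframe_def fp kappa by (simp add: twist_def p scaleR_conv_of_real Complex_eq algebra_simps)
  also have "fuv * (v * d\<phi>) - B * v * (v\<^sup>2 * d\<phi> - u\<^sup>2 * d\<theta>) = n d\<phi> d\<theta>"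
    by (simp add: fuv_def n_def algebra_simps)
  also have "fuv * (u * d\<theta>) + A * u * (v\<^sup>2 * d\<phi> - u\<^sup>2 * d\<theta>) = m d\<phi> d\<theta>"
    by (simp add: fuv_def m_def algebra_simps)
  finally show ?thesis .
qed

lemma f_cover: "f (of_real v * cis \<phi>, of_real u * cis \<theta>) = fuv"
proof -
  have cc: "cnj (of_real r * cis t) * (of_real r * cis t) = of_real (r\<^sup>2)" for r t
    by (simp add: cis_cnj cis_mult mult_ac power2_eq_square)
  show ?thesis
    unfolding f_def half_df_def fst_conv snd_conv cc by (simp add: fuv_def)
qed

lemma inner_rotate: "(w * cis t) \<bullet> (w' * cis t) = w \<bullet> w'"
proof -
  have "(w * c) \<bullet> (w' * c) = (cmod c)\<^sup>2 * (w \<bullet> w')" for c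
    unfolding cmod_power2 by (simp add: inner_complex_def algebra_simps power2_eq_square)
  then show ?thesis by simp
qed

lemma metric_model:
  fixes \<phi> \<theta>
  defines "p \<equiv> (of_real v * cis \<phi>, of_real u * cis \<theta>)"
  defines "T \<equiv> \<lambda>(du, dv, d\<phi>, d\<theta>). (Complex dv (v * d\<phi>) * cis \<phi>, Complex du (u * d\<theta>) * cis \<theta>)"
  shows "metric p (T X) (T Y) = gtn_model_metric \<alpha> \<beta> (point u v \<phi> \<theta>) (tangent u v X) (tangent u v Y)"
    and "metric p (complex_structure p (T X)) (T Y) = gtn_model_form \<alpha> \<beta> (point u v \<phi> \<theta>) (tangent u v X) (tangent u v Y)"
proof -
  obtain du dv d\<phi> d\<theta> where X: "X = (du, dv, d\<phi>, d\<theta>)" by (metis prod.collapse)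
  obtain du' dv' d\<phi>' d\<theta>' where Y: "Y = (du', dv', d\<phi>', d\<theta>')" by (metis prod.collapse)
  have fp: "f p = fuv" unfolding p_def by (rule f_cover)
  note coframeT = coframe_cover[OF meta_eq_to_obj_eq[OF p_def]]
  show "metric p (T X) (T Y) = gtn_model_metric \<alpha> \<beta> (point u v \<phi> \<theta>) (tangent u v X) (tangent u v Y)"
    unfolding X Y model_metric metric_def T_def prod.case coframeT s_def fp inner_prod_def fst_conv snd_conv inner_rotate
    by (simp add: inner_complex_def algebra_simps power2_eq_square)
  have i: "times_i (Complex a b * cis t, Complex a' b' * cis t') = (Complex (- b) a * cis t, Complex (- b') a' * cis t')"
    for a b t a' b' t'
    by (simp add: times_i_def Complex_eq algebra_simps)
  have cancel: "2 / M / fuv * a = 2 / M * b" if "a = fuv * b" for a b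
    using that fuv_pos by simp
  show "metric p (complex_structure p (T X)) (T Y) = gtn_model_form \<alpha> \<beta> (point u v \<phi> \<theta>) (tangent u v X) (tangent u v Y)"
    unfolding X Y model_form metric_def coframe_complex_structure T_def prod.case coframeT i s_def fp inner_prod_def fst_conv snd_conv
      inner_rotate
    by (rule cancel) (simp add: inner_complex_def algebra_simps)
qed

end

lemma polar_tangent:
  assumes "v > 0"
  shows "\<exists>dv d\<phi>. w = Complex dv (v * d\<phi>) * cis \<phi>"
proof (intro exI)
  have "Complex (Re (w * cis (- \<phi>))) (v * (Im (w * cis (- \<phi>)) / v)) = w * cis (- \<phi>)"
    using assms by (simp only: times_divide_eq_right) (simp add: complex_eq_iff)
  then show "w = Complex (Re (w * cis (- \<phi>))) (v * (Im (w * cis (- \<phi>)) / v)) * cis \<phi>"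
    by (simp add: mult.assoc cis_mult)
qed

text \<open>The complement of the axes is dense, so smooth objects on the plane are determined by their values there.\<close>

lemma closure_nonzero: "closure {p :: C2. fst p \<noteq> 0 \<and> snd p \<noteq> 0} = UNIV"
proof -
  have "{p :: C2. fst p \<noteq> 0 \<and> snd p \<noteq> 0} = (- {0}) \<times> (- {0})" by auto
  then show ?thesis by (simp add: closure_Times closure_complement)
qed

lemma eq_if_eq_nonzero:
  fixes F G :: "C2 \<Rightarrow> 'b::real_normed_vector"
  assumes "continuous_on UNIV F" "continuous_on UNIV G" "\<And>p. fst p \<noteq> 0 \<Longrightarrow> snd p \<noteq> 0 \<Longrightarrow> F p = G p"
  shows "F p = G p"
proof -
  have "closed {p. F p = G p}" by (rule closed_Collect_eq[OF assms(1,2)])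
  then have "closure {p :: C2. fst p \<noteq> 0 \<and> snd p \<noteq> 0} \<subseteq> {p. F p = G p}"
    by (rule closure_minimal[rotated]) (use assms(3) in auto)
  then show ?thesis by (auto simp: closure_nonzero)
qed

text \<open>Off the axes the covering and its differential are onto, so the metric is determined by the model metric and, by
  nondegeneracy, the complex structure by the model form; both agree with the explicit ones by \<open>metric_model\<close>.\<close>

theorem generalized_taub_nut_eq:
  assumes "generalized_taub_nut \<alpha> \<beta> g J"
  shows "g = metric" and "J = complex_structure"
proof -
  have gJ: "g p X Y = metric p X Y" "J p X = complex_structure p X" if p: "fst p \<noteq> 0" "snd p \<noteq> 0" for p X Y
  proof -
    define u v \<phi> \<theta> where "u = cmod (snd p)" and "v = cmod (fst p)" and "\<phi> = Arg (fst p)" and "\<theta> = Arg (snd p)"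
    have u: "u > 0" and v: "v > 0" using p by (simp_all add: u_def v_def)
    have p_eq: "p = (of_real v * cis \<phi>, of_real u * cis \<theta>)"
      using rcis_cmod_Arg[of "fst p"] rcis_cmod_Arg[of "snd p"]
      by (simp add: prod_eq_iff rcis_def u_def v_def \<phi>_def \<theta>_def)
    define T where "T = (\<lambda>(du, dv, d\<phi>, d\<theta>). (Complex dv (v * d\<phi>) * cis \<phi>, Complex du (u * d\<theta>) * cis \<theta>))"
    have surj: "\<exists>Z. X = T Z" for X
    proof -
      obtain dv d\<phi> where "fst X = Complex dv (v * d\<phi>) * cis \<phi>" using polar_tangent[OF v] by blast
      moreover obtain du d\<theta> where "snd X = Complex du (u * d\<theta>) * cis \<theta>" using polar_tangent[OF u] by blast
      ultimately have "X = T (du, dv, d\<phi>, d\<theta>)" by (simp add: T_def prod_eq_iff)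
      then show ?thesis ..
    qed
    have pos: "fst (point u v \<phi> \<theta>) > 0" using u v M_pos by (simp add: point_def)
    have \<Phi>: "gtn_cover \<alpha> \<beta> (point u v \<phi> \<theta>) = p" unfolding p_eq by (rule cover_point[OF u v])
    have d\<Phi>: "frechet_derivative (gtn_cover \<alpha> \<beta>) (at (point u v \<phi> \<theta>)) (tangent u v Z) = T Z" for Z
      unfolding T_def by (cases Z) (simp add: cover_deriv[OF u v])
    have "g p (T X) (T Y) = gtn_model_metric \<alpha> \<beta> (point u v \<phi> \<theta>) (tangent u v X) (tangent u v Y)"
      "g p (J p (T X)) (T Y) = gtn_model_form \<alpha> \<beta> (point u v \<phi> \<theta>) (tangent u v X) (tangent u v Y)" for X Y
      using assms pos unfolding generalized_taub_nut_def Let_def by (metis \<Phi> d\<Phi>)+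
    then have "g p (T X) (T Y) = metric p (T X) (T Y)"
      "g p (J p (T X)) (T Y) = metric p (complex_structure p (T X)) (T Y)" for X Y
      by (simp_all add: metric_model[OF u v, of \<phi> \<theta>, folded p_eq] T_def)
    then have g: "g p X Y = metric p X Y" and J: "g p (J p X) Y = metric p (complex_structure p X) Y" for X Y
      using surj by metis+
    show "g p X Y = metric p X Y" by (rule g)
    show "J p X = complex_structure p X"
      by (rule metric_nondegenerate[of p]) (metis g J)
  qed
  have smooth: "smooth_on UNIV (\<lambda>p. g p X Y)" "smooth_on UNIV (\<lambda>p. J p X)" for X Y
    using assms unfolding generalized_taub_nut_def by blast+
  have "g p X Y = metric p X Y" for p X Y
    by (rule eq_if_eq_nonzero[OF smooth(1)[THEN smooth_on_imp_continuous_on]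
          smooth_metric[THEN smooth_on_imp_continuous_on] gJ(1)])
  then show "g = metric" by blast
  have "J p X = complex_structure p X" for p X
    by (rule eq_if_eq_nonzero[OF smooth(2)[THEN smooth_on_imp_continuous_on]
          smooth_complex_structure[THEN smooth_on_imp_continuous_on] gJ(2)])
  then show "J = complex_structure" by blast
qed

lemma open_dense_nonzero: "open_dense_in {p :: C2. fst p \<noteq> 0 \<and> snd p \<noteq> 0} UNIV"
  unfolding open_dense_in_def closure_nonzero
  by (simp add: open_Collect_conj open_Collect_neq continuous_on_fst continuous_on_snd continuous_on_id)

end

section \<open>The main result\<close>

theorem theorem3p1:
  fixes \<alpha> \<beta> k M :: real
    and g :: "complex \<times> complex \<Rightarrow> complex \<times> complex \<Rightarrow> complex \<times> complex \<Rightarrow> real"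
    and J :: "complex \<times> complex \<Rightarrow> complex \<times> complex \<Rightarrow> complex \<times> complex"
  assumes "\<alpha> \<ge> 0" and "\<beta> \<ge> 0" and "\<alpha> + \<beta> > 0"
    and "k = (\<alpha> - \<beta>) / (\<alpha> + \<beta>)" and "M = (\<alpha> + \<beta>) / (2 * sqrt 2)"
    and "generalized_taub_nut \<alpha> \<beta> g J"
    and "-1 < k" and "k < 1"
  shows "QCH_of_orthotoric_type UNIV g J \<and>
    (\<exists>a b c d :: real. a > 0 \<and> c > 0 \<and> d * a - b * c > 0 \<and>
       M = (c + a) * a\<^sup>2 * c\<^sup>2 / (4 * (d * a - b * c)\<^sup>2) \<and>
       k = (a - c) / (a + c) \<and>
       (\<exists>U. open_dense_in U UNIV \<and>
          locally_orthotoric U g (\<lambda>\<xi>. a * \<xi> + b) (\<lambda>\<eta>. c * \<eta> + d)))"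
proof -
  define A B where "A = 1 + k" and "B = 1 - k"
  have M: "M > 0" using assms(3,5) by simp
  have kk: "k * (\<alpha> + \<beta>) = \<alpha> - \<beta>" using assms(3,4) by simp
  have MM: "sqrt 2 * M = (\<alpha> + \<beta>) / 2"
    using real_div_sqrt[of 2] assms(5) by simp
  interpret gtn A B M \<alpha> \<beta>
  proof
    show "\<alpha> = sqrt 2 * M * A" "\<beta> = sqrt 2 * M * B"
      unfolding MM A_def B_def using kk by (simp_all add: algebra_simps)
  qed (use assms M in \<open>auto simp: A_def B_def\<close>)
  have g: "g = metric" and J: "J = complex_structure"
    using generalized_taub_nut_eq[OF assms(6)] by simp_all
  let ?U = "{p :: C2. fst p \<noteq> 0 \<and> snd p \<noteq> 0}"
  \<comment> \<open>The values of \<open>a\<close>, \<open>b\<close>, \<open>c\<close>, \<open>d\<close> are \<open>8 * A / M\<close>, \<open>0\<close>, \<open>8 * B / M\<close> and \<open>16 * B / M\<^sup>2\<close>. A common translation of \<open>\<xi>\<close> and \<open>\<eta>\<close> would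
      change \<open>b\<close> and \<open>d\<close>; here it is fixed by \<open>b = 0\<close>.\<close>
  have "orthotoric_type_kaehler_surface ?U g J"
    unfolding orthotoric_type_kaehler_surface_def g J
    using kaehler_surface_open_subset[OF kaehler, of ?U] open_dense_nonzero locally_orthotoric
    by (auto simp: open_dense_in_def)
  then have "QCH_of_orthotoric_type UNIV g J"
    unfolding QCH_of_orthotoric_type_def using QCH open_dense_nonzero g J by blast
  moreover have "8 * A / M > 0" "8 * B / M > 0" using A_pos B_pos M by simp_all
  moreover have "(16 * B / M\<^sup>2) * (8 * A / M) - 0 * (8 * B / M) > 0" using A_pos B_pos M by simp
  moreover have "M = (8 * B / M + 8 * A / M) * (8 * A / M)\<^sup>2 * (8 * B / M)\<^sup>2 /
      (4 * ((16 * B / M\<^sup>2) * (8 * A / M) - 0 * (8 * B / M))\<^sup>2)"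
  proof -
    have "8 * B / M + 8 * A / M = 16 / M" using AB by (simp flip: add_divide_distrib)
    then show ?thesis using A_pos B_pos M by (simp add: field_simps power2_eq_square)
  qed
  moreover have "k = (8 * A / M - 8 * B / M) / (8 * A / M + 8 * B / M)"
    using M by (simp add: A_def B_def field_simps)
  moreover have "locally_orthotoric ?U g (\<lambda>\<xi>. 8 * A / M * \<xi> + 0) (\<lambda>\<eta>. 8 * B / M * \<eta> + 16 * B / M\<^sup>2)"
    using locally_orthotoric by (simp add: g power2_eq_square)
  ultimately show ?thesis
    using open_dense_nonzero by blast
qed

end
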